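(* Consider the symmetric Gaussian interfering multiple access channel (IMAC) with parameters $(P_1,P_2,h_1,h_2)$, and let $\mathcal{C}$ be its capacity region. Suppose the channel has mixed strong--extremely strong interference MSES$(1,2)$, i.e. $$h_2^2\ge 1+P_1+P_2+h_1^2P_1\quad\text{and}\quad h_1^2\ge 1 .$$ Then $$\mathcal{C}=\left\{(R_1,R_2,R_3,R_4)\in\mathbb{R}_+^4:\ (R_1,R_2,R_3)\in\mathcal{C}^M(\{1,2,3\},1),\ (R_1,R_3,R_4)\in\mathcal{C}^M(\{1,3,4\},2)\right\}.$$
   Context: Channel model. Let $P_1,P_2\ge 0$ and $h_1,h_2\in\mathbb{R}$; put $P_3=P_1$, $P_4=P_2$. The IMAC with parameters $(P_1,P_2,h_1,h_2)$ is the memoryless channel with four real inputs $X_1,\dots,X_4$ and two real outputs $$Y_1=X_1+X_2+h_1X_3+h_2X_4+Z_1,\qquad Y_2=h_1X_1+h_2X_2+X_3+X_4+Z_2,$$ where $Z_1,Z_2\sim\mathcal{N}(0,1)$ are independent of each other, i.i.d. over time, and independent of the inputs. Transmitters 1 and 2 have messages for receiver 1 (observing $Y_1$); transmitters 3 and 4 have messages for receiver 2 (observing $Y_2$). Codes and capacity. An $(n,2^{nR_1},2^{nR_2},2^{nR_3},2^{nR_4})$ code consists of message sets $\mathcal{M}_i=\{1,\dots,2^{nR_i}\}$ (with $2^{nR_i}$ rounded up to an integer), encoders $f_i:\mathcal{M}_i\to\mathbb{R}^n$, $i=1,2,3,4$, and decoders $g_i:\mathbb{R}^n\to\mathcal{M}_i$,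 with $g_1,g_2$ applied to $Y_1^n$ and $g_3,g_4$ applied to $Y_2^n$. The messages $M_i$ are independent and uniform on $\mathcal{M}_i$, $X_i^n=f_i(M_i)$, and the average power constraints $\frac1n\sum_{t=1}^n\mathbb{E}[X_{i,t}^2]\le P_i$ must hold for $i=1,2,3,4$. With $\hat M_i$ the decoder outputs, the error probability is $P_e^{(n)}=P(\hat M_i\ne M_i\text{ for some }i)$. A tuple $(R_1,R_2,R_3,R_4)$ of nonnegative reals is achievable if there is a sequence of such codes with $P_e^{(n)}\to0$ as $n\to\infty$. The capacity region $\mathcal{C}$ is the closure of the set of achievable tuples. MAC regions. Let $h_{ij}$ be the coefficient from transmitter $i$ to receiver $j$: $h_{11}=h_{21}=h_{32}=h_{42}=1$, $h_{31}=h_{12}=h_1$, $h_{41}=h_{22}=h_2$. For $\mathcal{S}\subseteq\{1,2,3,4\}$, $j\in\{1,2\}$, $N>0$, $\mathcal{C}^M(\mathcal{S},j,N)\subseteq\mathbb{R}_+^{|\mathcal{S}|}$ is the capacity region of the Gaussian multiple access channel from the transmitters in $\mathcal{S}$ to receiver $j$ with noise variance $N$, i.e. the set of $(R_i)_{i\in\mathcal{S}}$ with $R_i\ge0$ and $$\sum_{i\in\mathcal{T}}R_i\le\tfrac12\log\Big(1+\sum_{i\in\mathcal{T}}h_{ij}^2P_i/N\Big)\quad\text{for all }\mathcal{T}\subseteq\mathcal{S}.$$ Abbreviate $\mathcal{C}^M(\mathcal{S},j)=\mathcal{C}^M(\mathcal{S},j,1)$. Logarithms are to base 2. *)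

theory Defs
  imports "HOL-Probability.Probability"
begin

text \<open>
  Transmitters are the elements of the four-element type \<^typ>\<open>4\<close>, receivers those of the
  two-element type \<^typ>\<open>2\<close> (there, \<open>4 = 0\<close> and \<open>2 = 0\<close> respectively, which does no harm: the
  labels are only compared for equality). Rate tuples are vectors of type \<^typ>\<open>real ^ 4\<close>.
\<close>

definition imac_power :: "real \<Rightarrow> real \<Rightarrow> 4 \<Rightarrow> real" where
  "imac_power P1 P2 i = (if i = 1 \<or> i = 3 then P1 else P2)"

text \<open>\<open>imac_gain h1 h2 i j\<close> is the coefficient from transmitter \<open>i\<close> to receiver \<open>j\<close>.\<close>

definition imac_gain :: "real \<Rightarrow> real \<Rightarrow> 4 \<Rightarrow> 2 \<Rightarrow> real" where
  "imac_gain h1 h2 i j =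
     (if j = 1
      then (if i = 1 \<or> i = 2 then 1 else if i = 3 then h1 else h2)
      else (if i = 1 then h1 else if i = 2 then h2 else 1))"

definition intended_receiver :: "4 \<Rightarrow> 2" where
  "intended_receiver i = (if i = 1 \<or> i = 2 then 1 else 2)"


text \<open>
  Blocks of length \<open>n\<close> are the extensional functions on \<^term>\<open>{..<n}\<close>, with the product
  Borel \<open>\<sigma>\<close>-algebra.
\<close>

abbreviation block_space :: "nat \<Rightarrow> (nat \<Rightarrow> real) measure" where
  "block_space n \<equiv> \<Pi>\<^sub>M t\<in>{..<n}. (borel :: real measure)"

definition message_set :: "nat \<Rightarrow> real \<Rightarrow> nat set" where
  "message_set n r = {1..nat \<lceil>2 powr (real n * r)\<rceil>}"

text \<open>
  The underlying probability space: a sample \<open>(m, z)\<close> consists of the messages \<open>m i\<close> of the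
  transmitters, independent and uniform, and, independently of them, of the independent
  standard normal noise samples \<open>z j t\<close> at receiver \<open>j\<close> and time \<open>t\<close>.
\<close>

definition message_space :: "nat \<Rightarrow> real ^ 4 \<Rightarrow> (4 \<Rightarrow> nat) measure" where
  "message_space n R = (\<Pi>\<^sub>M i\<in>UNIV. uniform_count_measure (message_set n (R $ i)))"

definition noise_space :: "nat \<Rightarrow> (2 \<Rightarrow> nat \<Rightarrow> real) measure" where
  "noise_space n = (\<Pi>\<^sub>M j\<in>UNIV. \<Pi>\<^sub>M t\<in>{..<n}. density lborel std_normal_density)"

definition sample_space :: "nat \<Rightarrow> real ^ 4 \<Rightarrow> ((4 \<Rightarrow> nat) \<times> (2 \<Rightarrow> nat \<Rightarrow> real)) measure" where
  "sample_space n R = message_space n R \<Otimes>\<^sub>M noise_space n"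

definition channel_output ::
    "(4 \<Rightarrow> 2 \<Rightarrow> real) \<Rightarrow> nat \<Rightarrow> (4 \<Rightarrow> nat \<Rightarrow> nat \<Rightarrow> real) \<Rightarrow> 2
      \<Rightarrow> (4 \<Rightarrow> nat) \<times> (2 \<Rightarrow> nat \<Rightarrow> real) \<Rightarrow> nat \<Rightarrow> real" where
  "channel_output h n f j = (\<lambda>(m, z). \<lambda>t\<in>{..<n}. (\<Sum>i\<in>UNIV. h i j * f i (m i) t) + z j t)"

text \<open>
  \<open>f i\<close> is the encoder of transmitter \<open>i\<close>, and \<open>g i\<close> the decoder for the message of transmitter
  \<open>i\<close>. Decoders are required to be measurable, so that the error probability is defined.
\<close>

definition is_code ::
    "(4 \<Rightarrow> real) \<Rightarrow> nat \<Rightarrow> real ^ 4 \<Rightarrow> (4 \<Rightarrow> nat \<Rightarrow> nat \<Rightarrow> real) \<Rightarrow> (4 \<Rightarrow> (nat \<Rightarrow> real) \<Rightarrow> nat)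
      \<Rightarrow> bool" where
  "is_code P n R f g \<longleftrightarrow>
     (\<forall>i. f i \<in> message_set n (R $ i) \<rightarrow> space (block_space n)) \<and>
     (\<forall>i. g i \<in> block_space n \<rightarrow>\<^sub>M count_space (message_set n (R $ i))) \<and>
     (\<forall>i. 1 / real n * (\<Sum>t<n. \<integral>\<omega>. (f i (fst \<omega> i) t)\<^sup>2 \<partial>sample_space n R) \<le> P i)"

definition error_prob ::
    "(4 \<Rightarrow> 2 \<Rightarrow> real) \<Rightarrow> nat \<Rightarrow> real ^ 4 \<Rightarrow> (4 \<Rightarrow> nat \<Rightarrow> nat \<Rightarrow> real) \<Rightarrow> (4 \<Rightarrow> (nat \<Rightarrow> real) \<Rightarrow> nat)
      \<Rightarrow> real" where
  "error_prob h n R f g =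
     measure (sample_space n R)
       {\<omega> \<in> space (sample_space n R).
          \<exists>i. g i (channel_output h n f (intended_receiver i) \<omega>) \<noteq> fst \<omega> i}"

definition achievable :: "(4 \<Rightarrow> real) \<Rightarrow> (4 \<Rightarrow> 2 \<Rightarrow> real) \<Rightarrow> real ^ 4 \<Rightarrow> bool" where
  "achievable P h R \<longleftrightarrow>
     (\<forall>i. 0 \<le> R $ i) \<and>
     (\<exists>f g. (\<forall>n\<ge>1. is_code P n R (f n) (g n)) \<and>
            (\<lambda>n. error_prob h n R (f n) (g n)) \<longlonglongrightarrow> 0)"

definition capacity_region :: "(4 \<Rightarrow> real) \<Rightarrow> (4 \<Rightarrow> 2 \<Rightarrow> real) \<Rightarrow> (real ^ 4) set" where
  "capacity_region P h = closure {R. achievable P h R}"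

definition imac_capacity_region :: "real \<Rightarrow> real \<Rightarrow> real \<Rightarrow> real \<Rightarrow> (real ^ 4) set" where
  "imac_capacity_region P1 P2 h1 h2 = capacity_region (imac_power P1 P2) (imac_gain h1 h2)"


text \<open>
  The capacity region of the Gaussian multiple access channel from the transmitters in \<open>S\<close> to
  receiver \<open>j\<close> with noise variance \<open>N\<close>. Its elements are indexed by \<open>S\<close>, that is, they are
  extensional functions on \<open>S\<close>.
\<close>

definition mac_region ::
    "(4 \<Rightarrow> real) \<Rightarrow> (4 \<Rightarrow> 2 \<Rightarrow> real) \<Rightarrow> 4 set \<Rightarrow> 2 \<Rightarrow> real \<Rightarrow> (4 \<Rightarrow> real) set" where
  "mac_region P h S j N =
     {R \<in> S \<rightarrow>\<^sub>E {0..}.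
        \<forall>T\<subseteq>S. (\<Sum>i\<in>T. R i) \<le> 1/2 * log 2 (1 + (\<Sum>i\<in>T. (h i j)\<^sup>2 * P i / N))}"

definition imac_mac_region ::
    "real \<Rightarrow> real \<Rightarrow> real \<Rightarrow> real \<Rightarrow> 4 set \<Rightarrow> 2 \<Rightarrow> (4 \<Rightarrow> real) set" where
  "imac_mac_region P1 P2 h1 h2 S j = mac_region (imac_power P1 P2) (imac_gain h1 h2) S j 1"

definition mses_1_2 :: "real \<Rightarrow> real \<Rightarrow> real \<Rightarrow> real \<Rightarrow> bool" where
  "mses_1_2 P1 P2 h1 h2 \<longleftrightarrow> h2\<^sup>2 \<ge> 1 + P1 + P2 + h1\<^sup>2 * P1 \<and> h1\<^sup>2 \<ge> 1"

end

theory Submission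
  imports Defs
begin

text \<open>
  Achievability: every transmitter uses an i.i.d. Gaussian codebook of slightly reduced power, and both
  receivers jointly decode all four messages. Since \<open>h2\<close> exceeds the total power of noise and remaining
  signals, the interferer seen through \<open>h2\<close> could be decoded first, and so its presence adds no rate
  constraint beyond that of its own receiver.

  Converse: let the receiver know the message of the interferer seen through \<open>h2\<close>. After decoding its own
  messages it subtracts them; because \<open>\<bar>h1\<bar> \<ge> 1\<close> what remains, scaled and with independent noise added, has
  the law of the output of the other receiver, so that the third message is decoded as well. Fano's
  inequality with a white Gaussian output law then bounds the sum rates.
\<close>

section \<open>Gaussian vectors\<close>

text \<open>Entropy does not occur in either direction. Both compare the channel law given the
  codewords with a white Gaussian law through a likelihood ratio: the converse averages its
  logarithm, the random coding bound uses that the inverse ratio has mean one and applies Markov's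
  inequality. The remaining analytic input is Chebyshev's inequality for sums of squared normals.
  Three obstacles shape the rest. Codewords may have nonzero mean, which would put cross terms into
  the received power, so the converse moves the means into an offset known to the receiver. The
  genie-aided receiver can fail in two ways, each no likelier than an error of the code, hence the
  factor \<open>1 - 2 * error_prob\<close>. Random coding wants strict inequalities, which fail on
  the boundary and for transmitters without power. So the rate tuple is first scaled by a factor
  below one, and only sets of transmitters with positive rates are constrained: a zero rate leaves a
  single message, which cannot be confused. Taking the closure recovers the boundary.\<close>

abbreviation std_gauss :: "real measure" where
  "std_gauss \<equiv> density lborel std_normal_density"

lemma prob_space_std_gauss: "prob_space std_gauss"
  by (rule prob_space_normal_density) simp

lemma (in prob_space) normal_linear_form:
  fixes X :: "'i \<Rightarrow> 'a \<Rightarrow> real" and c :: "'i \<Rightarrow> real"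
  assumes "finite I" and ind: "indep_vars (\<lambda>_. borel) X I"
    and X: "\<And>i. i \<in> I \<Longrightarrow> distributed M lborel (X i) std_normal_density"
    and pos: "0 < (\<Sum>i\<in>I. (c i)\<^sup>2)"
  shows "distributed M lborel (\<lambda>\<omega>. \<Sum>i\<in>I. c i * X i \<omega>) (normal_density 0 (sqrt (\<Sum>i\<in>I. (c i)\<^sup>2)))"
proof -
  \<comment> \<open>A summand with coefficient zero has no normal density. Such coefficients do
    occur, for a vanishing gain or a transmitter without power.\<close>
  define J where "J = {i\<in>I. c i \<noteq> 0}"
  have J: "finite J" "J \<subseteq> I" using assms(1) by (auto simp: J_def)
  have sums: "(\<Sum>i\<in>J. c i * X i \<omega>) = (\<Sum>i\<in>I. c i * X i \<omega>)" "(\<Sum>i\<in>J. (c i)\<^sup>2) = (\<Sum>i\<in>I. (c i)\<^sup>2)" for \<omega>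
    by (rule sum.mono_neutral_left, use assms(1) in \<open>auto simp: J_def\<close>)+
  have ne: "J \<noteq> {}" using pos sums(2) by auto
  have indJ: "indep_vars (\<lambda>_. borel) (\<lambda>i \<omega>. c i * X i \<omega>) J"
    by (rule indep_vars_compose2[OF indep_vars_subset[OF ind J(2)], of "\<lambda>i x. c i * x"]) simp
  have "distributed M lborel (\<lambda>\<omega>. c i * X i \<omega>) (normal_density 0 \<bar>c i\<bar>)" if "i \<in> J" for i
    using normal_density_affine[OF X, of i "c i" 0] that J by (auto simp: J_def)
  then have "distributed M lborel (\<lambda>\<omega>. \<Sum>i\<in>J. c i * X i \<omega>)
      (normal_density (\<Sum>i\<in>J. 0) (sqrt (\<Sum>i\<in>J. \<bar>c i\<bar>\<^sup>2)))"
    by (intro sum_indep_normal[OF J(1) ne indJ]) (auto simp: J_def)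
  then show ?thesis by (simp add: sums)
qed

lemma (in prob_space) indep_vars_group:
  fixes X :: "'i \<Rightarrow> 'a \<Rightarrow> real"
  assumes "indep_vars (\<lambda>_. borel) X I" "\<And>k. k \<in> K \<Longrightarrow> J k \<subseteq> I" "disjoint_family_on J K"
    and f: "\<And>k. k \<in> K \<Longrightarrow> f k \<in> borel_measurable (\<Pi>\<^sub>M i\<in>J k. borel)"
  shows "indep_vars (\<lambda>_. borel) (\<lambda>k \<omega>. f k (\<lambda>i\<in>J k. X i \<omega>)) K"
  by (rule indep_vars_compose2[OF indep_vars_restrict[OF assms(1-3)] f])

lemma (in prob_space) indep_vars_linear_forms:
  fixes X :: "'i \<Rightarrow> 'a \<Rightarrow> real" and c :: "'i \<Rightarrow> real"
  assumes "indep_vars (\<lambda>_. borel) X I" "\<And>k. k \<in> K \<Longrightarrow> J k \<subseteq> I" "disjoint_family_on J K"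
  shows "indep_vars (\<lambda>_. borel) (\<lambda>k \<omega>. \<Sum>i\<in>J k. c i * X i \<omega>) K"
  using indep_vars_group[OF assms, where f="\<lambda>k x. \<Sum>i\<in>J k. c i * x i"] by simp

lemma (in prob_space) second_moment_sum_indep:
  fixes Y :: "'i \<Rightarrow> 'a \<Rightarrow> real"
  assumes "finite K" and ind: "indep_vars (\<lambda>_. borel) Y K"
    and sq: "\<And>k. k \<in> K \<Longrightarrow> integrable M (\<lambda>\<omega>. (Y k \<omega>)\<^sup>2)"
    and mean: "\<And>k. k \<in> K \<Longrightarrow> expectation (Y k) = 0"
  shows "integrable M (\<lambda>\<omega>. (\<Sum>k\<in>K. Y k \<omega>)\<^sup>2)"
    and "expectation (\<lambda>\<omega>. (\<Sum>k\<in>K. Y k \<omega>)\<^sup>2) = (\<Sum>k\<in>K. expectation (\<lambda>\<omega>. (Y k \<omega>)\<^sup>2))"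
proof -
  have rv: "random_variable borel (Y k)" if "k \<in> K" for k
    using ind that by (auto simp: indep_vars_def)
  have int: "integrable M (Y k)" if "k \<in> K" for k
    using square_integrable_imp_integrable[OF rv sq] that by blast
  have cross: "integrable M (\<lambda>\<omega>. Y k \<omega> * Y l \<omega>) \<and> expectation (\<lambda>\<omega>. Y k \<omega> * Y l \<omega>) = 0"
    if "k \<in> K" "l \<in> K" "k \<noteq> l" for k l
  proof -
    have *: "indep_vars (\<lambda>_. borel) Y {k, l}"
      by (rule indep_vars_subset[OF ind]) (use that in auto)
    show ?thesis
      using indep_vars_integrable[OF _ *] indep_vars_lebesgue_integral[OF _ *] int mean that by auto
  qed
  have prod: "integrable M (\<lambda>\<omega>. Y k \<omega> * Y l \<omega>)" if "k \<in> K" "l \<in> K" for k l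
    using cross[OF that] sq[OF that(1)] by (cases "k = l") (auto simp: power2_eq_square)
  have eq: "(\<lambda>\<omega>. (\<Sum>k\<in>K. Y k \<omega>)\<^sup>2) = (\<lambda>\<omega>. \<Sum>k\<in>K. \<Sum>l\<in>K. Y k \<omega> * Y l \<omega>)"
    by (simp add: power2_eq_square sum_product)
  show "integrable M (\<lambda>\<omega>. (\<Sum>k\<in>K. Y k \<omega>)\<^sup>2)"
    unfolding eq using prod by (intro Bochner_Integration.integrable_sum) auto
  have "expectation (\<lambda>\<omega>. (\<Sum>k\<in>K. Y k \<omega>)\<^sup>2) = (\<Sum>k\<in>K. \<Sum>l\<in>K. expectation (\<lambda>\<omega>. Y k \<omega> * Y l \<omega>))"
    unfolding eq using prod
    by (simp add: Bochner_Integration.integral_sum Bochner_Integration.integrable_sum)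
  also have "\<dots> = (\<Sum>k\<in>K. \<Sum>l\<in>K. if l = k then expectation (\<lambda>\<omega>. (Y k \<omega>)\<^sup>2) else 0)"
    using cross by (intro sum.cong) (auto simp: power2_eq_square)
  finally show "expectation (\<lambda>\<omega>. (\<Sum>k\<in>K. Y k \<omega>)\<^sup>2) = (\<Sum>k\<in>K. expectation (\<lambda>\<omega>. (Y k \<omega>)\<^sup>2))"
    using assms(1) by simp
qed

lemma (in prob_space) std_normal_moments:
  assumes X: "distributed M lborel X std_normal_density"
  shows "integrable M (\<lambda>\<omega>. X \<omega> ^ k)" "expectation X = 0" "expectation (\<lambda>\<omega>. (X \<omega>)\<^sup>2) = 1"
    "expectation (\<lambda>\<omega>. X \<omega> ^ 4) = 3"
proof -
  show "integrable M (\<lambda>\<omega>. X \<omega> ^ k)"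
    using distributed_integrable[OF X, of "\<lambda>x. x ^ k"] integrable_std_normal_moment[of k] by simp
  show "expectation X = 0"
    using distributed_integral[OF X, of "\<lambda>x. x"] integral_std_normal_moment_odd[of 0] by simp
  show "expectation (\<lambda>\<omega>. (X \<omega>)\<^sup>2) = 1"
    using distributed_integral[OF X, of "\<lambda>x. x\<^sup>2"] integral_std_normal_moment_even[of 1] by simp
  show "expectation (\<lambda>\<omega>. X \<omega> ^ 4) = 3"
    using distributed_integral[OF X, of "\<lambda>x. x ^ 4"] integral_std_normal_moment_even[of 2]
    by (simp add: fact_numeral)
qed

text \<open>Chebyshev's inequality for the centred squares. They are independent with variance 3 - 2
  + 1 = 2, by the moments of order four and two.\<close>

lemma (in prob_space) chi_square_concentration:
  fixes U :: "'i \<Rightarrow> 'a \<Rightarrow> real" and \<delta> :: real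
  assumes "finite K" "K \<noteq> {}" and ind: "indep_vars (\<lambda>_. borel) U K"
    and U: "\<And>k. k \<in> K \<Longrightarrow> distributed M lborel (U k) std_normal_density" and "0 < \<delta>"
  shows "prob {\<omega>\<in>space M. card K * \<delta> \<le> \<bar>(\<Sum>k\<in>K. (U k \<omega>)\<^sup>2) - card K\<bar>} \<le> 2 / (card K * \<delta>\<^sup>2)"
proof -
  define Y where "Y k \<omega> = (U k \<omega>)\<^sup>2 - 1" for k \<omega>
  have indY: "indep_vars (\<lambda>_. borel) Y K"
    unfolding Y_def by (rule indep_vars_compose2[OF ind]) auto
  have [measurable]: "random_variable borel (U k)" if "k \<in> K" for k
    using ind that by (auto simp: indep_vars_def)
  note mom = std_normal_moments[OF U]
  have Y2: "(\<lambda>\<omega>. (Y k \<omega>)\<^sup>2) = (\<lambda>\<omega>. U k \<omega> ^ 4 - 2 * (U k \<omega>)\<^sup>2 + 1)" for k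
    by (auto simp: Y_def power2_eq_square algebra_simps eval_nat_numeral)
  have sq: "integrable M (\<lambda>\<omega>. (Y k \<omega>)\<^sup>2)" "expectation (\<lambda>\<omega>. (Y k \<omega>)\<^sup>2) = 2" "expectation (Y k) = 0"
    if "k \<in> K" for k
    using mom[OF that] mom(1)[OF that, of 4] mom(1)[OF that, of 2]
    by (auto simp: Y2, auto simp: Y_def[abs_def] prob_space)
  define S where "S \<omega> = (\<Sum>k\<in>K. Y k \<omega>)" for \<omega>
  have S: "integrable M (\<lambda>\<omega>. (S \<omega>)\<^sup>2)" "expectation (\<lambda>\<omega>. (S \<omega>)\<^sup>2) = 2 * card K"
    using second_moment_sum_indep[OF assms(1) indY sq(1) sq(3)] sq(2) by (auto simp: S_def)
  have [measurable]: "random_variable borel S"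
    unfolding S_def Y_def by measurable
  have cK: "0 < real (card K)" using assms by (simp add: card_gt_0_iff)
  have "prob {\<omega>\<in>space M. card K * \<delta> \<le> \<bar>S \<omega>\<bar>} \<le> (2 * card K) / (card K * \<delta>)\<^sup>2"
    using second_moment_method[OF _ S(1), of "card K * \<delta>"] S(2) cK \<open>0 < \<delta>\<close> by simp
  also have "\<dots> = 2 / (card K * \<delta>\<^sup>2)"
    using cK by (simp add: power2_eq_square)
  finally show ?thesis
    by (simp add: S_def Y_def sum_subtractf)
qed

lemma ball_Plus: "(\<forall>k\<in>I <+> J. P k) \<longleftrightarrow> (\<forall>i\<in>I. P (Inl i)) \<and> (\<forall>j\<in>J. P (Inr j))"
  by auto

text \<open>Relabelling both components of the pair space by a disjoint sum gives one independent
  family, so that linear forms mixing codebook entries with noise samples (or two noises) need no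
  special treatment. Independence is read off the joint law, which agrees with the product law on
  boxes.\<close>

lemma indep_vars_std_gauss_pair:
  fixes I :: "'i set" and J :: "'j set"
  assumes fin: "finite I" "finite J"
  defines "M \<equiv> PiM I (\<lambda>_. std_gauss) \<Otimes>\<^sub>M PiM J (\<lambda>_. std_gauss)"
    and "X \<equiv> case_sum (\<lambda>i \<omega>. fst \<omega> i) (\<lambda>j \<omega>. snd \<omega> j)"
  shows "prob_space M" "prob_space.indep_vars M (\<lambda>_. borel) X (I <+> J)"
    "\<And>k. k \<in> I <+> J \<Longrightarrow> distributed M lborel (X k) std_normal_density"
proof -
  interpret N: prob_space std_gauss by (rule prob_space_std_gauss)
  interpret P: product_prob_space "\<lambda>_::'i. std_gauss" I by unfold_locales
  interpret Q: product_prob_space "\<lambda>_::'j. std_gauss" J by unfold_locales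
  interpret PQ: product_prob_space "\<lambda>_::'i+'j. std_gauss" "I <+> J" by unfold_locales
  have pI: "prob_space (PiM I (\<lambda>_. std_gauss))" and pJ: "prob_space (PiM J (\<lambda>_. std_gauss))"
    by (intro prob_space_PiM prob_space_std_gauss)+
  interpret PP: pair_prob_space "PiM I (\<lambda>_. std_gauss)" "PiM J (\<lambda>_. std_gauss)"
    using pI pJ by (simp add: pair_prob_space_def pair_sigma_finite_def prob_space_imp_sigma_finite)
  show M: "prob_space M" unfolding M_def by unfold_locales
  interpret M: prob_space M by fact
  have rv: "X k \<in> borel_measurable M" if "k \<in> I <+> J" for k
    using that by (auto simp: X_def M_def)
  have joint: "distr M (\<Pi>\<^sub>M i\<in>I <+> J. borel) (\<lambda>x. \<lambda>k\<in>I <+> J. X k x) = (\<Pi>\<^sub>M i\<in>I <+> J. std_gauss)"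
  proof (rule PQ.PiM_eqI)
    show "finite (I <+> J)" using fin by simp
    show "sets (distr M (\<Pi>\<^sub>M i\<in>I <+> J. borel) (\<lambda>x. \<lambda>k\<in>I <+> J. X k x)) = sets (\<Pi>\<^sub>M i\<in>I <+> J. std_gauss)"
      unfolding sets_distr by (rule sets_PiM_cong) auto
    fix A :: "'i + 'j \<Rightarrow> real set" assume "\<And>i. i \<in> I <+> J \<Longrightarrow> A i \<in> sets std_gauss"
    then have A: "A k \<in> sets borel" if "k \<in> I <+> J" for k using that by auto
    have A': "\<And>i. i \<in> I \<Longrightarrow> A (Inl i) \<in> sets borel" "\<And>j. j \<in> J \<Longrightarrow> A (Inr j) \<in> sets borel"
      using A by auto
    have "(\<lambda>x. \<lambda>k\<in>I <+> J. X k x) -` Pi\<^sub>E (I <+> J) A \<inter> space M = Pi\<^sub>E I (\<lambda>i. A (Inl i)) \<times> Pi\<^sub>E J (\<lambda>j. A (Inr j))"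
      by (auto simp: M_def X_def space_pair_measure space_PiM PiE_iff ball_Plus)
    then have "emeasure (distr M (\<Pi>\<^sub>M i\<in>I <+> J. borel) (\<lambda>x. \<lambda>k\<in>I <+> J. X k x)) (Pi\<^sub>E (I <+> J) A)
        = emeasure M (Pi\<^sub>E I (\<lambda>i. A (Inl i)) \<times> Pi\<^sub>E J (\<lambda>j. A (Inr j)))"
      using A fin by (subst emeasure_distr) (auto intro!: measurable_restrict rv sets_PiM_I_finite)
    also have "\<dots> = emeasure (PiM I (\<lambda>_. std_gauss)) (Pi\<^sub>E I (\<lambda>i. A (Inl i))) *
        emeasure (PiM J (\<lambda>_. std_gauss)) (Pi\<^sub>E J (\<lambda>j. A (Inr j)))"
      unfolding M_def using A' fin
      by (intro sigma_finite_measure.emeasure_pair_measure_Times[OF prob_space_imp_sigma_finite[OF pJ]] sets_PiM_I_finite) auto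
    also have "\<dots> = (\<Prod>i\<in>I. emeasure std_gauss (A (Inl i))) * (\<Prod>j\<in>J. emeasure std_gauss (A (Inr j)))"
      using A' fin by (simp add: P.emeasure_PiM Q.emeasure_PiM)
    also have "\<dots> = (\<Prod>i\<in>I <+> J. emeasure std_gauss (A i))"
      using fin by (simp add: prod.Plus)
    finally show "emeasure (distr M (\<Pi>\<^sub>M i\<in>I <+> J. borel) (\<lambda>x. \<lambda>k\<in>I <+> J. X k x)) (Pi\<^sub>E (I <+> J) A)
        = (\<Prod>i\<in>I <+> J. emeasure std_gauss (A i))" .
  qed
  have dX: "distr M borel (X k) = std_gauss" if "k \<in> I <+> J" for k
  proof -
    have "distr M borel (X k) = distr (distr M (\<Pi>\<^sub>M i\<in>I <+> J. borel) (\<lambda>x. \<lambda>k\<in>I <+> J. X k x)) borel (\<lambda>x. x k)"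
      using that rv by (subst distr_distr) (auto simp: comp_def intro!: distr_cong measurable_restrict)
    also have "\<dots> = distr (\<Pi>\<^sub>M i\<in>I <+> J. std_gauss) std_gauss (\<lambda>x. x k)"
      unfolding joint by (intro distr_cong) auto
    finally show ?thesis using PQ.PiM_component[OF that] by simp
  qed
  show "distributed M lborel (X k) std_normal_density" if "k \<in> I <+> J" for k
  proof -
    have "distr M lborel (X k) = std_gauss"
      using dX[OF that] by (metis distr_cong sets_lborel)
    then show ?thesis
      using rv[OF that] by (auto simp: distributed_def)
  qed
  show "M.indep_vars (\<lambda>_. borel) X (I <+> J)"
  proof (cases "I <+> J = {}")
    case True
    show ?thesis unfolding True M.indep_vars_def M.indep_sets_def by auto
  next
    case False
    note joint
    also have "(\<Pi>\<^sub>M i\<in>I <+> J. std_gauss) = (\<Pi>\<^sub>M i\<in>I <+> J. distr M borel (X i))"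
      by (intro PiM_cong) (auto simp: dX)
    finally show ?thesis
      using False rv by (subst M.indep_vars_iff_distr_eq_PiM') auto
  qed
qed

text \<open>Change of measure: weighted with the likelihood ratio, the law of the shifted noise
  becomes white Gaussian with standard deviation \<open>\<sigma>\<close>, whatever the shift. It
  suffices to compare boxes, where both sides factor into one-dimensional integrals.\<close>

lemma nn_integral_shift_std_gauss:
  fixes I :: "'i set" and \<sigma> :: real and x :: "'i \<Rightarrow> real"
  assumes fin: "finite I" and \<sigma>: "0 < \<sigma>" and F[measurable]: "F \<in> borel_measurable (\<Pi>\<^sub>M i\<in>I. (borel :: real measure))"
  shows "(\<integral>\<^sup>+z. (\<Prod>i\<in>I. ennreal (normal_density 0 \<sigma> (x i + z i) / std_normal_density (z i)))
      * F (\<lambda>i\<in>I. x i + z i) \<partial>PiM I (\<lambda>_. std_gauss)) = (\<integral>\<^sup>+y. F y \<partial>PiM I (\<lambda>_. density lborel (normal_density 0 \<sigma>)))"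
proof -
  interpret N: prob_space std_gauss by (rule prob_space_std_gauss)
  interpret Q: prob_space "density lborel (normal_density 0 \<sigma>)" using \<sigma> by (rule prob_space_normal_density)
  interpret P: product_prob_space "\<lambda>_::'i. std_gauss" I by unfold_locales
  interpret PQ: product_prob_space "\<lambda>_::'i. density lborel (normal_density 0 \<sigma>)" I by unfold_locales
  define r where "r i z = ennreal (normal_density 0 \<sigma> (x i + z) / std_normal_density z)" for i z
  have [measurable]: "r i \<in> borel_measurable borel" for i unfolding r_def by measurable
  have [measurable]: "(\<lambda>z. \<lambda>i\<in>I. x i + z i) \<in> PiM I (\<lambda>_. std_gauss) \<rightarrow>\<^sub>M (\<Pi>\<^sub>M i\<in>I. (borel :: real measure))"
    by (intro measurable_restrict) simp
  have single: "(\<integral>\<^sup>+z. r i z * indicator A (x i + z) \<partial>std_gauss) = emeasure (density lborel (normal_density 0 \<sigma>)) A"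
    if [measurable]: "A \<in> sets borel" for A i
  proof -
    have "(\<integral>\<^sup>+z. r i z * indicator A (x i + z) \<partial>std_gauss)
        = (\<integral>\<^sup>+z. std_normal_density z * (r i z * indicator A (x i + z)) \<partial>lborel)"
      by (subst nn_integral_density) auto
    also have "\<dots> = (\<integral>\<^sup>+z. ennreal (normal_density 0 \<sigma> (x i + 1 * z)) * indicator A (x i + 1 * z) \<partial>lborel)"
    proof (rule nn_integral_cong)
      fix z
      have "0 < std_normal_density z" by (rule normal_density_pos) simp
      then have "ennreal (std_normal_density z) * r i z = ennreal (normal_density 0 \<sigma> (x i + z))"
        unfolding r_def by (subst ennreal_mult[symmetric]) auto
      then show "ennreal (std_normal_density z) * (r i z * indicator A (x i + z))
          = ennreal (normal_density 0 \<sigma> (x i + 1 * z)) * indicator A (x i + 1 * z)"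
        by (simp add: mult.assoc[symmetric])
    qed
    also have "\<dots> = (\<integral>\<^sup>+y. ennreal (normal_density 0 \<sigma> y) * indicator A y \<partial>lborel)"
      by (subst (2) nn_integral_real_affine[where c=1 and t="x i"]) auto
    finally show ?thesis by (simp add: emeasure_density)
  qed
  have "distr (density (PiM I (\<lambda>_. std_gauss)) (\<lambda>z. \<Prod>i\<in>I. r i (z i))) (\<Pi>\<^sub>M i\<in>I. borel) (\<lambda>z. \<lambda>i\<in>I. x i + z i)
    = PiM I (\<lambda>_. density lborel (normal_density 0 \<sigma>))" (is "?D = _")
  proof (rule PQ.PiM_eqI[OF fin])
    show "sets ?D = sets (PiM I (\<lambda>_. density lborel (normal_density 0 \<sigma>)))"
      unfolding sets_distr by (rule sets_PiM_cong) auto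
    fix A assume "\<And>i. i \<in> I \<Longrightarrow> A i \<in> sets (density lborel (normal_density 0 \<sigma>))"
    then have A[measurable]: "\<And>i. i \<in> I \<Longrightarrow> A i \<in> sets borel" by simp
    have A'[measurable]: "Pi\<^sub>E I A \<in> sets (\<Pi>\<^sub>M i\<in>I. borel)"
      using fin A by (intro sets_PiM_I_finite) auto
    have "emeasure ?D (Pi\<^sub>E I A) = (\<integral>\<^sup>+y. indicator (Pi\<^sub>E I A) y \<partial>?D)"
      by simp
    also have "\<dots> = (\<integral>\<^sup>+z. (\<Prod>i\<in>I. r i (z i)) * indicator (Pi\<^sub>E I A) (\<lambda>i\<in>I. x i + z i) \<partial>PiM I (\<lambda>_. std_gauss))"
      by (subst nn_integral_distr, simp, simp, subst nn_integral_density) auto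
    also have "\<dots> = (\<integral>\<^sup>+z. (\<Prod>i\<in>I. r i (z i) * indicator (A i) (x i + z i)) \<partial>PiM I (\<lambda>_. std_gauss))"
      using fin by (intro nn_integral_cong)
        (auto simp: prod.distrib indicator_def PiE_iff prod_zero_iff space_PiM split: if_splits intro!: arg_cong2[where f="(*)"] sym[OF prod.neutral])
    also have "\<dots> = (\<Prod>i\<in>I. \<integral>\<^sup>+z. r i z * indicator (A i) (x i + z) \<partial>std_gauss)"
      using fin by (intro P.product_nn_integral_prod) auto
    also have "\<dots> = (\<Prod>i\<in>I. emeasure (density lborel (normal_density 0 \<sigma>)) (A i))"
      by (intro prod.cong single) auto
    finally show "emeasure ?D (Pi\<^sub>E I A) = (\<Prod>i\<in>I. emeasure (density lborel (normal_density 0 \<sigma>)) (A i))" .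
  qed
  then have "(\<integral>\<^sup>+y. F y \<partial>PiM I (\<lambda>_. density lborel (normal_density 0 \<sigma>))) = (\<integral>\<^sup>+y. F y \<partial>?D)"
    by simp
  also have "\<dots> = (\<integral>\<^sup>+z. (\<Prod>i\<in>I. r i (z i)) * F (\<lambda>i\<in>I. x i + z i) \<partial>PiM I (\<lambda>_. std_gauss))"
    by (subst nn_integral_distr, simp, simp, subst nn_integral_density) auto
  finally show ?thesis by (simp add: r_def)
qed

text \<open>For a fixed value \<open>x\<close> of \<open>X\<close>, the density of \<open>B\<close>
  cancels and the standard normal density centred at \<open>x\<close> remains, which has mass one.
  Later \<open>B\<close> is a received sample and \<open>X\<close> the unrelated contribution of
  wrong codewords.\<close>

lemma (in prob_space) nn_integral_gauss_ratio:
  fixes B X :: "'a \<Rightarrow> real"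
  assumes ind: "indep_var borel X borel B" and B: "distributed M lborel B (normal_density 0 \<sigma>)" and \<sigma>: "0 < \<sigma>"
  shows "(\<integral>\<^sup>+\<omega>. ennreal (std_normal_density (B \<omega> - X \<omega>) / normal_density 0 \<sigma> (B \<omega>)) \<partial>M) = 1"
proof -
  have [measurable]: "X \<in> borel_measurable M" "B \<in> borel_measurable M"
    using ind by (auto simp: indep_var_eq)
  define r where "r x b = ennreal (std_normal_density (b - x) / normal_density 0 \<sigma> b)" for x b
  have [measurable]: "case_prod r \<in> borel_measurable (borel \<Otimes>\<^sub>M borel)"
    unfolding r_def by measurable
  have distrB: "distr M borel B = density lborel (normal_density 0 \<sigma>)"
    using B unfolding distributed_def by (metis distr_cong sets_lborel)
  interpret XX: prob_space "distr M borel X" by (rule prob_space_distr) simp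
  interpret BB: prob_space "distr M borel B" by (rule prob_space_distr) simp
  have inner: "(\<integral>\<^sup>+b. r x b \<partial>distr M borel B) = 1" for x
  proof -
    have "(\<integral>\<^sup>+b. r x b \<partial>distr M borel B) = (\<integral>\<^sup>+b. normal_density 0 \<sigma> b * r x b \<partial>lborel)"
      unfolding distrB by (subst nn_integral_density) (auto simp: r_def)
    also have "\<dots> = (\<integral>\<^sup>+b. ennreal (std_normal_density (- x + 1 * b)) \<partial>lborel)"
    proof (rule nn_integral_cong)
      fix b
      have "0 < normal_density 0 \<sigma> b" using \<sigma> by (rule normal_density_pos)
      then show "ennreal (normal_density 0 \<sigma> b) * r x b = ennreal (std_normal_density (- x + 1 * b))"
        unfolding r_def by (subst ennreal_mult[symmetric]) auto
    qed
    also have "\<dots> = (\<integral>\<^sup>+b. std_normal_density b \<partial>lborel)"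
      by (subst (2) nn_integral_real_affine[where c=1 and t="-x"]) auto
    also have "\<dots> = 1"
      using prob_space.emeasure_space_1[OF prob_space_std_gauss] by (simp add: emeasure_density)
    finally show ?thesis .
  qed
  have "(\<integral>\<^sup>+\<omega>. r (X \<omega>) (B \<omega>) \<partial>M) = (\<integral>\<^sup>+p. case_prod r p \<partial>distr M (borel \<Otimes>\<^sub>M borel) (\<lambda>\<omega>. (X \<omega>, B \<omega>)))"
    by (subst nn_integral_distr) auto
  also have "\<dots> = (\<integral>\<^sup>+p. case_prod r p \<partial>(distr M borel X \<Otimes>\<^sub>M distr M borel B))"
    using ind unfolding indep_var_distribution_eq by simp
  also have "\<dots> = (\<integral>\<^sup>+x. \<integral>\<^sup>+b. r x b \<partial>distr M borel B \<partial>distr M borel X)"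
    by (subst BB.nn_integral_fst[symmetric]) auto
  also have "\<dots> = 1"
    by (simp only: inner nn_integral_const XX.emeasure_space_1) simp
  finally show ?thesis by (simp add: r_def)
qed

section \<open>The sample space of a code\<close>

text \<open>Rounding up harms neither direction: the converse uses the lower bound on the number of
  messages, the union bound counts only wrong messages, and there the rounding is absorbed by the
  subtracted one.\<close>

lemma message_set: "finite (message_set n r)" "0 < card (message_set n r)" "message_set n r \<noteq> {}"
  "1 \<in> message_set n r"
  and card_message_set_ge: "2 powr (real n * r) \<le> card (message_set n r)"
  and card_message_set_le: "real (card (message_set n r)) - 1 \<le> 2 powr (real n * r)"
proof -
  have "0 < (2::real) powr (real n * r)" by simp
  then have *: "1 \<le> \<lceil>2 powr (real n * r)\<rceil>" by linarith
  show "finite (message_set n r)" by (simp add: message_set_def)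
  show "0 < card (message_set n r)" "1 \<in> message_set n r" using *
    by (simp_all add: message_set_def Suc_le_eq)
  then show "message_set n r \<noteq> {}" by auto
  have "real (card (message_set n r)) = real_of_int \<lceil>2 powr (real n * r)\<rceil>"
    using * by (simp add: message_set_def)
  then show "2 powr (real n * r) \<le> card (message_set n r)" "real (card (message_set n r)) - 1 \<le> 2 powr (real n * r)"
    using * by linarith+
qed

definition message_tuples :: "nat \<Rightarrow> real ^ 4 \<Rightarrow> (4 \<Rightarrow> nat) set" where
  "message_tuples n R = (\<Pi>\<^sub>E i\<in>UNIV. message_set n (R $ i))"

lemma message_tuples: "finite (message_tuples n R)" "0 < card (message_tuples n R)" "message_tuples n R \<noteq> {}"
  and card_message_tuples: "card (message_tuples n R) = (\<Prod>i\<in>UNIV. card (message_set n (R $ i)))"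
proof -
  show *: "card (message_tuples n R) = (\<Prod>i\<in>UNIV. card (message_set n (R $ i)))"
    unfolding message_tuples_def by (rule card_PiE) simp
  show "0 < card (message_tuples n R)"
    unfolding * by (intro prod_pos ballI message_set)
  then show "finite (message_tuples n R)" "message_tuples n R \<noteq> {}"
    by (auto simp: card_gt_0_iff)
qed

lemma message_tuplesD: "m \<in> message_tuples n R \<Longrightarrow> m i \<in> message_set n (R $ i)"
  by (auto simp: message_tuples_def)

text \<open>Turns probabilities over the messages into finite averages, so that everything below can
  be argued for one fixed message tuple at a time.\<close>

lemma message_space_eq: "message_space n R = uniform_count_measure (message_tuples n R)"
proof (rule measure_eqI_finite)
  interpret U: product_prob_space "\<lambda>i. uniform_count_measure (message_set n (R $ i))" "UNIV :: 4 set"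
    by (intro product_prob_spaceI prob_space_uniform_count_measure message_set)
  have sp: "space (message_space n R) = message_tuples n R"
    by (simp add: message_space_def space_PiM message_tuples_def space_uniform_count_measure)
  have single: "{m} = (\<Pi>\<^sub>E i\<in>UNIV. {m i})" for m :: "4 \<Rightarrow> nat"
    by (auto simp: fun_eq_iff PiE_iff)
  have singl_sets: "{m} \<in> sets (message_space n R)" if "m \<in> message_tuples n R" for m
    unfolding single[of m] message_space_def
    by (rule sets_PiM_I_finite) (use that in \<open>auto simp: sets_uniform_count_measure message_tuplesD\<close>)
  show "sets (message_space n R) = Pow (message_tuples n R)"
  proof (intro equalityI subsetI)
    fix X assume "X \<in> Pow (message_tuples n R)"
    then have X: "X \<subseteq> message_tuples n R" by simp
    then have "countable X" by (metis X countable_finite finite_subset message_tuples(1))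
    with X show "X \<in> sets (message_space n R)"
      by (meson sets.countable singl_sets subsetD)
  qed (use sets.sets_into_space sp in blast)
  show "sets (uniform_count_measure (message_tuples n R)) = Pow (message_tuples n R)"
    by (simp add: sets_uniform_count_measure)
  show "finite (message_tuples n R)" by (rule message_tuples)
  fix m assume m: "m \<in> message_tuples n R"
  have "emeasure (message_space n R) {m}
      = (\<Prod>i\<in>UNIV. emeasure (uniform_count_measure (message_set n (R $ i))) {m i})"
    unfolding single[of m] message_space_def
    by (rule U.emeasure_PiM) (use m in \<open>auto simp: sets_uniform_count_measure message_tuplesD\<close>)
  also have "\<dots> = (\<Prod>i\<in>UNIV. ennreal (1 / card (message_set n (R $ i))))"
    using m by (intro prod.cong) (auto simp: emeasure_uniform_count_measure message_set message_tuplesD)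
  also have "\<dots> = ennreal (1 / card (message_tuples n R))"
    by (simp add: prod_ennreal card_message_tuples prod_dividef)
  finally show "emeasure (message_space n R) {m} = emeasure (uniform_count_measure (message_tuples n R)) {m}"
    using m by (simp add: emeasure_uniform_count_measure message_tuples)
qed

lemma prob_space_message_space: "prob_space (message_space n R)"
  unfolding message_space_eq by (rule prob_space_uniform_count_measure) (rule message_tuples)+

lemma prob_space_noise_space: "prob_space (noise_space n)"
  unfolding noise_space_def by (intro prob_space_PiM prob_space_std_gauss)

lemma measure_sample_space:
  assumes Q: "\<And>m. m \<in> message_tuples n R \<Longrightarrow> {z \<in> space (noise_space n). Q m z} \<in> sets (noise_space n)"
  shows "measure (sample_space n R) {\<omega> \<in> space (sample_space n R). Q (fst \<omega>) (snd \<omega>)}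
    = (\<Sum>m\<in>message_tuples n R. measure (noise_space n) {z \<in> space (noise_space n). Q m z}) / card (message_tuples n R)"
proof -
  let ?A = "message_tuples n R"
  interpret M: prob_space "message_space n R" by (rule prob_space_message_space)
  interpret Z: prob_space "noise_space n" by (rule prob_space_noise_space)
  interpret P: pair_prob_space "message_space n R" "noise_space n" ..
  have sp: "space (message_space n R) = ?A" "sets (message_space n R) = Pow ?A"
    by (simp_all add: message_space_eq space_uniform_count_measure sets_uniform_count_measure)
  let ?Z = "\<lambda>m. {z \<in> space (noise_space n). Q m z}"
  have "{\<omega> \<in> space (sample_space n R). Q (fst \<omega>) (snd \<omega>)} = (\<Union>m\<in>?A. {m} \<times> ?Z m)"
    by (auto simp: sample_space_def space_pair_measure sp)
  also have "measure (sample_space n R) \<dots> = (\<Sum>m\<in>?A. measure (sample_space n R) ({m} \<times> ?Z m))"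
    unfolding sample_space_def
    by (rule P.finite_measure_finite_Union)
      (auto simp: message_tuples disjoint_family_on_def sp intro!: pair_measureI Q)
  also have "\<dots> = (\<Sum>m\<in>?A. measure (noise_space n) (?Z m) / card ?A)"
  proof (rule sum.cong[OF refl])
    fix m assume m: "m \<in> ?A"
    have "emeasure (sample_space n R) ({m} \<times> ?Z m) = emeasure (message_space n R) {m} * emeasure (noise_space n) (?Z m)"
      unfolding sample_space_def by (rule Z.emeasure_pair_measure_Times) (use m Q sp in auto)
    also have "emeasure (message_space n R) {m} = ennreal (1 / card ?A)"
      using m by (simp add: message_space_eq emeasure_uniform_count_measure message_tuples)
    finally show "measure (sample_space n R) ({m} \<times> ?Z m) = measure (noise_space n) (?Z m) / card ?A"
      by (simp add: measure_def enn2real_mult)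
  qed
  finally show ?thesis by (simp add: sum_divide_distrib)
qed

lemma integral_sample_space_message:
  fixes F :: "nat \<Rightarrow> real"
  shows "(\<integral>\<omega>. F (fst \<omega> i) \<partial>sample_space n R) = (\<Sum>k\<in>message_set n (R $ i). F k) / card (message_set n (R $ i))"
proof -
  let ?U = "\<lambda>i. uniform_count_measure (message_set n (R $ i))"
  have U: "prob_space (?U i)" for i
    by (intro prob_space_uniform_count_measure message_set)
  have F: "F \<in> borel_measurable (?U i)"
    by (auto simp: measurable_def sets_uniform_count_measure space_uniform_count_measure)
  have i: "(\<lambda>m. m i) \<in> message_space n R \<rightarrow>\<^sub>M ?U i"
    unfolding message_space_def by measurable
  have "(\<integral>\<omega>. F (fst \<omega> i) \<partial>sample_space n R) = (\<integral>m. F (m i) \<partial>distr (sample_space n R) (message_space n R) fst)"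
    using F i by (subst integral_distr) (auto simp: sample_space_def comp_def intro: measurable_compose)
  also have "distr (sample_space n R) (message_space n R) fst = message_space n R"
    unfolding sample_space_def by (rule prob_space.distr_pair_fst[OF prob_space_noise_space])
  also have "(\<integral>m. F (m i) \<partial>message_space n R) = (\<integral>k. F k \<partial>distr (message_space n R) (?U i) (\<lambda>m. m i))"
    using F i by (subst integral_distr) auto
  also have "distr (message_space n R) (?U i) (\<lambda>m. m i) = ?U i"
    unfolding message_space_def by (rule distr_PiM_component) (auto intro: U)
  also have "(\<integral>k. F k \<partial>?U i) = (\<Sum>k\<in>message_set n (R $ i). F k) / card (message_set n (R $ i))"
    by (rule integral_uniform_count_measure) (rule message_set)
  finally show ?thesis .
qed

abbreviation white_noise :: "nat \<Rightarrow> (nat \<Rightarrow> real) measure" where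
  "white_noise n \<equiv> \<Pi>\<^sub>M t\<in>{..<n}. std_gauss"

lemma prob_space_white_noise: "prob_space (white_noise n)"
  by (intro prob_space_PiM prob_space_std_gauss)

lemma noise_space_component [measurable]: "(\<lambda>z. z j) \<in> noise_space n \<rightarrow>\<^sub>M white_noise n"
  unfolding noise_space_def by measurable

lemma measure_noise_component:
  assumes [measurable]: "Measurable.pred (white_noise n) P"
  shows "measure (noise_space n) {z \<in> space (noise_space n). P (z j)} = measure (white_noise n) {z \<in> space (white_noise n). P z}"
proof -
  have "white_noise n = distr (noise_space n) (white_noise n) (\<lambda>z. z j)"
    unfolding noise_space_def by (rule distr_PiM_component[symmetric]) (auto intro: prob_space_white_noise)
  then have "measure (white_noise n) {z \<in> space (white_noise n). P z}
      = measure (distr (noise_space n) (white_noise n) (\<lambda>z. z j)) {z \<in> space (white_noise n). P z}"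
    by simp
  also have "\<dots> = measure (noise_space n) {z \<in> space (noise_space n). P (z j)}"
    by (subst measure_distr) (auto intro!: arg_cong2[where f=measure] simp: measurable_space[OF noise_space_component])
  finally show ?thesis by simp
qed

text \<open>\<open>channel_output\<close> with the noise of the single receiver as argument. This
  allows feeding it a noise vector simulated at the other receiver.\<close>

definition received :: "(4 \<Rightarrow> 2 \<Rightarrow> real) \<Rightarrow> nat \<Rightarrow> (4 \<Rightarrow> nat \<Rightarrow> nat \<Rightarrow> real) \<Rightarrow> 2 \<Rightarrow> (4 \<Rightarrow> nat) \<Rightarrow> (nat \<Rightarrow> real) \<Rightarrow> nat \<Rightarrow> real" where
  "received h n f j m z = (\<lambda>t\<in>{..<n}. (\<Sum>i\<in>UNIV. h i j * f i (m i) t) + z t)"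

lemma received_measurable [measurable]: "received h n f j m \<in> white_noise n \<rightarrow>\<^sub>M block_space n"
  unfolding received_def by (intro measurable_restrict) simp

lemma pred_decoder_eq:
  assumes g: "g \<in> block_space n \<rightarrow>\<^sub>M count_space (message_set n r)"
  shows "Measurable.pred (white_noise n) (\<lambda>z. g (received h n f j m z) \<noteq> k)"
proof -
  have [measurable]: "(\<lambda>z. g (received h n f j m z)) \<in> white_noise n \<rightarrow>\<^sub>M count_space (message_set n r)"
    by (rule measurable_compose[OF received_measurable g])
  show ?thesis by measurable
qed

lemma error_prob_eq:
  assumes g: "\<And>i. g i \<in> block_space n \<rightarrow>\<^sub>M count_space (message_set n (R $ i))"
  shows "error_prob h n R f g = (\<Sum>m\<in>message_tuples n R. measure (noise_space n) {z \<in> space (noise_space n).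
      \<exists>i. g i (received h n f (intended_receiver i) m (z (intended_receiver i))) \<noteq> m i}) / card (message_tuples n R)"
proof -
  have "error_prob h n R f g = measure (sample_space n R) {\<omega> \<in> space (sample_space n R).
      \<exists>i. g i (received h n f (intended_receiver i) (fst \<omega>) (snd \<omega> (intended_receiver i))) \<noteq> fst \<omega> i}"
    by (simp add: error_prob_def channel_output_def received_def case_prod_unfold)
  also have "\<dots> = (\<Sum>m\<in>message_tuples n R. measure (noise_space n) {z \<in> space (noise_space n).
      \<exists>i. g i (received h n f (intended_receiver i) m (z (intended_receiver i))) \<noteq> m i}) / card (message_tuples n R)"
  proof (rule measure_sample_space)
    fix m
    have [measurable]: "Measurable.pred (noise_space n)
        (\<lambda>z. g i (received h n f (intended_receiver i) m (z (intended_receiver i))) \<noteq> m i)" for i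
      by (rule measurable_compose[OF noise_space_component pred_decoder_eq[OF g]])
    show "{z \<in> space (noise_space n). \<exists>i. g i (received h n f (intended_receiver i) m (z (intended_receiver i))) \<noteq> m i}
        \<in> sets (noise_space n)"
      by measurable
  qed
  finally show ?thesis .
qed

section \<open>Converse\<close>

lemma ln_normal_density_ratio:
  assumes "0 < s"
  shows "ln (normal_density 0 (sqrt s) y / std_normal_density z) = - ln s / 2 - y\<^sup>2 / (2 * s) + z\<^sup>2 / 2"
proof -
  have "ln (normal_density 0 (sqrt s) y) = - ln (sqrt (2 * pi * s)) - y\<^sup>2 / (2 * s)"
    using assms by (simp add: normal_density_def ln_mult ln_div)
  moreover have "ln (std_normal_density z) = - ln (sqrt (2 * pi)) - z\<^sup>2 / 2"
    by (simp add: normal_density_def ln_mult ln_div)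
  moreover have "ln (sqrt (2 * pi * s)) = ln (sqrt (2 * pi)) + ln s / 2"
    using assms by (simp add: real_sqrt_mult ln_mult ln_sqrt)
  moreover have "0 < normal_density 0 (sqrt s) y" "0 < std_normal_density z"
    using assms by (auto intro!: normal_density_pos)
  ultimately show ?thesis
    by (simp add: ln_div)
qed

text \<open>
  Fano's inequality in variational form: \<open>ln u \<le> u - 1\<close> is applied to the likelihood ratio of the white
  Gaussian output law of variance \<open>s\<close> and the channel law, tilted by \<open>K\<close> on the decision region. The second
  component of the observation is independent randomness available to the decoder.
\<close>

lemma gaussian_fano:
  fixes x :: "'m \<Rightarrow> nat \<Rightarrow> real" and D :: "'m \<Rightarrow> ((nat \<Rightarrow> real) \<times> (nat \<Rightarrow> real)) set" and K s :: real and n :: nat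
  defines "\<Omega> \<equiv> white_noise n \<Otimes>\<^sub>M white_noise n"
  assumes A: "finite A" "A \<noteq> {}" and K: "1 \<le> K" and s: "1 \<le> s"
    and D[measurable]: "\<And>m. D m \<in> sets (block_space n \<Otimes>\<^sub>M block_space n)"
    and count: "\<And>y. K * card {m\<in>A. y \<in> D m} \<le> card A"
    and pow: "(\<Sum>m\<in>A. \<Sum>t<n. (x m t)\<^sup>2) \<le> card A * n * (s - 1)"
  shows "(\<Sum>m\<in>A. measure \<Omega> {\<omega>\<in>space \<Omega>. (\<lambda>t\<in>{..<n}. x m t + fst \<omega> t, snd \<omega>) \<in> D m}) / card A * ln K
    \<le> n / 2 * ln s + ln 2"
proof -
  have fin: "finite {..<n}" by simp
  note G = indep_vars_std_gauss_pair[OF fin fin, folded \<Omega>_def]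
  interpret prob_space \<Omega> by (rule G(1))
  interpret W: prob_space "white_noise n" by (rule prob_space_white_noise)
  interpret pair_sigma_finite "white_noise n" "white_noise n" ..
  let ?Q = "\<Pi>\<^sub>M t\<in>{..<n}. density lborel (normal_density 0 (sqrt s))"
  have s0: "0 < s" using s by simp
  interpret Q: prob_space ?Q
    using s0 by (intro prob_space_PiM prob_space_normal_density) simp
  have cA: "0 < real (card A)" using A by (simp add: card_gt_0_iff)
  define I where "I m \<omega> = indicat_real (D m) (\<lambda>t\<in>{..<n}. x m t + fst \<omega> t, snd \<omega>)" for m \<omega>
  \<comment> \<open>Density of the white Gaussian output law over that of the channel law given
    \<open>m\<close>, at the actual output. The mean of its logarithm \<open>\<Lambda> m\<close> is
    minus the relative entropy of the two laws.\<close>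
  define L where "L m \<omega> = (\<Prod>t<n. normal_density 0 (sqrt s) (x m t + fst \<omega> t) / std_normal_density (fst \<omega> t))"
    for m and \<omega> :: "(nat \<Rightarrow> real) \<times> (nat \<Rightarrow> real)"
  define \<Lambda> where "\<Lambda> m \<omega> = (\<Sum>t<n. - ln s / 2 - (x m t + fst \<omega> t)\<^sup>2 / (2 * s) + (fst \<omega> t)\<^sup>2 / 2)"
    for m and \<omega> :: "(nat \<Rightarrow> real) \<times> (nat \<Rightarrow> real)"
  define c where "c m y = 1 + (K - 1) * indicat_real (D m) y" for m y
  have shift[measurable]: "(\<lambda>\<omega>. (\<lambda>t\<in>{..<n}. x m t + fst \<omega> t, snd \<omega>)) \<in> \<Omega> \<rightarrow>\<^sub>M block_space n \<Otimes>\<^sub>M block_space n" for m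
    unfolding \<Omega>_def by (intro measurable_Pair measurable_restrict) (auto intro!: measurable_compose[OF measurable_snd] measurable_ident_sets sets_PiM_cong)
  have [measurable]: "I m \<in> borel_measurable \<Omega>" "c m \<in> borel_measurable (block_space n \<Otimes>\<^sub>M block_space n)" for m
    unfolding I_def c_def by measurable
  have [measurable]: "L m \<in> borel_measurable \<Omega>" for m
    unfolding L_def \<Omega>_def by measurable
  have L_pos: "0 < L m \<omega>" for m \<omega>
    unfolding L_def using s0 by (intro prod_pos divide_pos_pos normal_density_pos) auto
  have nz: "normal_density 0 (sqrt s) y \<noteq> 0" "std_normal_density y \<noteq> 0" for y
    using normal_density_pos[of "sqrt s" 0 y] normal_density_pos[of 1 0 y] s0 by auto
  have ln_L: "ln (L m \<omega>) = \<Lambda> m \<omega>" for m \<omega>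
    unfolding L_def \<Lambda>_def using s0 nz
    by (subst ln_prod) (auto simp: ln_normal_density_ratio)
  have c_pos: "1 \<le> c m y" "c m y \<le> K" for m y
    unfolding c_def using K by (auto simp: indicator_def)
  define cI where "cI m \<omega> = c m (\<lambda>t\<in>{..<n}. x m t + fst \<omega> t, snd \<omega>)" for m \<omega>
  have [measurable]: "cI m \<in> borel_measurable \<Omega>" for m
    unfolding cI_def by measurable
  have ln_c: "ln (cI m \<omega>) = ln K * I m \<omega>" for m \<omega>
    unfolding I_def cI_def c_def using K by (auto simp: indicator_def)
  \<comment> \<open>The inequality \<open>ln u \<le> u - 1\<close> at half the tilted ratio. The
    divisor 2 is the bound on the average tilt shown in \<open>c_sum\<close>; it makes the
    right-hand side nonpositive on average up to \<open>ln 2\<close>, the counterpart of the entropy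
    term in Fano's inequality.\<close>
  have pointwise: "ln K * I m \<omega> + \<Lambda> m \<omega> \<le> cI m \<omega> * L m \<omega> / 2 - 1 + ln 2" for m \<omega>
  proof -
    have "0 < cI m \<omega>" using c_pos(1) by (simp add: cI_def less_le_trans[OF zero_less_one])
    then have "ln (cI m \<omega> * L m \<omega> / 2) = ln K * I m \<omega> + \<Lambda> m \<omega> - ln 2"
      using L_pos[of m \<omega>] by (simp add: ln_div ln_mult ln_c ln_L)
    moreover have "ln (cI m \<omega> * L m \<omega> / 2) \<le> cI m \<omega> * L m \<omega> / 2 - 1"
      using \<open>0 < cI m \<omega>\<close> L_pos[of m \<omega>] by (intro ln_le_minus_one) simp
    ultimately show ?thesis by simp
  qed
  \<comment> \<open>The weight \<open>L m\<close> replaces the output law by one that no longer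
    depends on \<open>m\<close>, so that the sum over \<open>m\<close> can be taken under the
    integral.\<close>
  have tilt: "(\<integral>\<^sup>+\<omega>. ennreal (cI m \<omega> * L m \<omega>) \<partial>\<Omega>) = (\<integral>\<^sup>+v. \<integral>\<^sup>+y. ennreal (c m (y, v)) \<partial>?Q \<partial>white_noise n)" for m
  proof -
    have "(\<integral>\<^sup>+\<omega>. ennreal (cI m \<omega> * L m \<omega>) \<partial>\<Omega>) = (\<integral>\<^sup>+v. \<integral>\<^sup>+z. ennreal (cI m (z, v) * L m (z, v)) \<partial>white_noise n \<partial>white_noise n)"
      unfolding \<Omega>_def by (subst nn_integral_snd[symmetric]) (auto simp: \<Omega>_def[symmetric])
    also have "\<dots> = (\<integral>\<^sup>+v. \<integral>\<^sup>+y. ennreal (c m (y, v)) \<partial>?Q \<partial>white_noise n)"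
    proof (rule nn_integral_cong)
      fix v assume v: "v \<in> space (white_noise n)"
      then have "v \<in> space (block_space n)" by (simp add: space_PiM)
      then have meas: "(\<lambda>y. ennreal (c m (y, v))) \<in> borel_measurable (\<Pi>\<^sub>M t\<in>{..<n}. borel)"
        by measurable
      have "(\<integral>\<^sup>+z. ennreal (cI m (z, v) * L m (z, v)) \<partial>white_noise n)
          = (\<integral>\<^sup>+z. (\<Prod>t<n. ennreal (normal_density 0 (sqrt s) (x m t + z t) / std_normal_density (z t)))
             * ennreal (c m (\<lambda>t\<in>{..<n}. x m t + z t, v)) \<partial>white_noise n)"
        unfolding cI_def L_def using c_pos(1)[THEN order_trans[OF zero_le_one]]
        by (intro nn_integral_cong) (simp add: ennreal_mult prod_ennreal prod_nonneg mult.commute)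
      also have "\<dots> = (\<integral>\<^sup>+y. ennreal (c m (y, v)) \<partial>?Q)"
        by (rule nn_integral_shift_std_gauss[OF fin _ meas]) (use s0 in simp)
      finally show "(\<integral>\<^sup>+z. ennreal (cI m (z, v) * L m (z, v)) \<partial>white_noise n) = (\<integral>\<^sup>+y. ennreal (c m (y, v)) \<partial>?Q)" .
    qed
    finally show ?thesis .
  qed
  \<comment> \<open>At most a fraction 1/K of the messages claims \<open>y\<close>, so the average
    tilt is at most 1 + (K - 1)/K.\<close>
  have c_sum: "(\<Sum>m\<in>A. c m y) \<le> 2 * card A" for y
  proof -
    have "(\<Sum>m\<in>A. c m y) = card A + (K - 1) * card {m\<in>A. y \<in> D m}"
      using A(1) by (simp add: c_def sum.distrib sum_distrib_left[symmetric] indicator_def sum.If_cases Int_def)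
    then show ?thesis using count[of y] by (simp add: algebra_simps)
  qed
  have tilt_sum: "(\<Sum>m\<in>A. \<integral>\<^sup>+\<omega>. ennreal (cI m \<omega> * L m \<omega>) \<partial>\<Omega>) \<le> ennreal (2 * card A)"
  proof -
    have [measurable_cong]: "sets ?Q = sets (block_space n)" "sets (white_noise n) = sets (block_space n)"
      by (auto intro!: sets_PiM_cong)
    have "(\<Sum>m\<in>A. \<integral>\<^sup>+\<omega>. ennreal (cI m \<omega> * L m \<omega>) \<partial>\<Omega>)
        = (\<integral>\<^sup>+v. \<integral>\<^sup>+y. (\<Sum>m\<in>A. ennreal (c m (y, v))) \<partial>?Q \<partial>white_noise n)"
    proof -
      have "(\<Sum>m\<in>A. \<integral>\<^sup>+\<omega>. ennreal (cI m \<omega> * L m \<omega>) \<partial>\<Omega>)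
          = (\<integral>\<^sup>+v. (\<Sum>m\<in>A. \<integral>\<^sup>+y. ennreal (c m (y, v)) \<partial>?Q) \<partial>white_noise n)"
        unfolding tilt by (rule nn_integral_sum[symmetric]) measurable
      also have "\<dots> = (\<integral>\<^sup>+v. \<integral>\<^sup>+y. (\<Sum>m\<in>A. ennreal (c m (y, v))) \<partial>?Q \<partial>white_noise n)"
        by (intro nn_integral_cong nn_integral_sum[symmetric]) (measurable, simp add: space_PiM)
      finally show ?thesis .
    qed
    also have "\<dots> \<le> (\<integral>\<^sup>+v. \<integral>\<^sup>+y. ennreal (2 * card A) \<partial>?Q \<partial>white_noise n)"
      using c_sum c_pos(1)[THEN order_trans[OF zero_le_one]]
      by (intro nn_integral_mono) (simp add: ennreal_leI)
    also have "\<dots> = ennreal (2 * card A)"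
      using Q.emeasure_space_1 W.emeasure_space_1 by simp
    finally show ?thesis .
  qed
  \<comment> \<open>Integrability comes from the bound just shown, since a nonnegative summand is at
    most the whole sum.\<close>
  have int_tilt: "integrable \<Omega> (\<lambda>\<omega>. cI m \<omega> * L m \<omega>)"
    and tilt_int: "(\<integral>\<^sup>+\<omega>. ennreal (cI m \<omega> * L m \<omega>) \<partial>\<Omega>) = ennreal (expectation (\<lambda>\<omega>. cI m \<omega> * L m \<omega>))" if "m \<in> A" for m
  proof -
    have nonneg: "0 \<le> cI m \<omega> * L m \<omega>" for \<omega>
      using L_pos[of m \<omega>] c_pos(1)[THEN order_trans[OF zero_le_one]] by (simp add: cI_def)
    have "(\<integral>\<^sup>+\<omega>. ennreal (cI m \<omega> * L m \<omega>) \<partial>\<Omega>) \<le> (\<Sum>m\<in>A. \<integral>\<^sup>+\<omega>. ennreal (cI m \<omega> * L m \<omega>) \<partial>\<Omega>)"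
      using A(1) that by (intro member_le_sum) auto
    also note tilt_sum
    finally show int: "integrable \<Omega> (\<lambda>\<omega>. cI m \<omega> * L m \<omega>)"
      using nonneg by (intro integrableI_nonneg) (auto intro: le_less_trans)
    show "(\<integral>\<^sup>+\<omega>. ennreal (cI m \<omega> * L m \<omega>) \<partial>\<Omega>) = ennreal (expectation (\<lambda>\<omega>. cI m \<omega> * L m \<omega>))"
      using nonneg by (intro nn_integral_eq_integral int) auto
  qed
  have E_tilt: "(\<Sum>m\<in>A. expectation (\<lambda>\<omega>. cI m \<omega> * L m \<omega>)) \<le> 2 * card A"
  proof -
    have "(\<Sum>m\<in>A. \<integral>\<^sup>+\<omega>. ennreal (cI m \<omega> * L m \<omega>) \<partial>\<Omega>) = (\<Sum>m\<in>A. ennreal (expectation (\<lambda>\<omega>. cI m \<omega> * L m \<omega>)))"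
      by (rule sum.cong[OF refl]) (rule tilt_int)
    also have "\<dots> = ennreal (\<Sum>m\<in>A. expectation (\<lambda>\<omega>. cI m \<omega> * L m \<omega>))"
      using L_pos[THEN less_imp_le] c_pos(1)[THEN order_trans[OF zero_le_one]]
      by (intro sum_ennreal integral_nonneg_AE AE_I2 mult_nonneg_nonneg) (auto simp: cI_def)
    finally have "ennreal (\<Sum>m\<in>A. expectation (\<lambda>\<omega>. cI m \<omega> * L m \<omega>)) \<le> ennreal (2 * real (card A))"
      using tilt_sum by simp
    then show ?thesis
      by (subst (asm) ennreal_le_iff) simp_all
  qed
  have Z: "distributed \<Omega> lborel (\<lambda>\<omega>. fst \<omega> t) std_normal_density" if "t < n" for t
    using G(3)[of "Inl t"] that by auto
  note mom = std_normal_moments[OF Z]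
  have summand: "integrable \<Omega> (\<lambda>\<omega>. - ln s / 2 - (x m t + fst \<omega> t)\<^sup>2 / (2 * s) + (fst \<omega> t)\<^sup>2 / 2) \<and>
      expectation (\<lambda>\<omega>. - ln s / 2 - (x m t + fst \<omega> t)\<^sup>2 / (2 * s) + (fst \<omega> t)\<^sup>2 / 2)
        = - ln s / 2 - ((x m t)\<^sup>2 + 1) / (2 * s) + 1 / 2" if "t < n" for m t
  proof -
    have *: "(\<lambda>\<omega>. - ln s / 2 - (x m t + fst \<omega> t)\<^sup>2 / (2 * s) + (fst \<omega> t)\<^sup>2 / 2)
      = (\<lambda>\<omega>. (- ln s / 2 - (x m t)\<^sup>2 / (2 * s)) - (x m t / s) * fst \<omega> t + (1/2 - 1 / (2 * s)) * (fst \<omega> t)\<^sup>2)"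
      using s0 by (auto simp: fun_eq_iff power2_eq_square field_simps)
    show ?thesis
      unfolding * using mom(1)[OF that, of 1] mom(1)[OF that, of 2] mom(2,3)[OF that] s0
      by (simp add: prob_space field_simps)
  qed
  have int_\<Lambda>: "integrable \<Omega> (\<Lambda> m)" for m
    unfolding \<Lambda>_def using summand by (intro Bochner_Integration.integrable_sum) auto
  have E_\<Lambda>: "expectation (\<Lambda> m) = (\<Sum>t<n. - ln s / 2 - ((x m t)\<^sup>2 + 1) / (2 * s) + 1 / 2)" for m
    unfolding \<Lambda>_def using summand by (subst Bochner_Integration.integral_sum) auto
  have E_I: "expectation (I m) = measure \<Omega> {\<omega>\<in>space \<Omega>. (\<lambda>t\<in>{..<n}. x m t + fst \<omega> t, snd \<omega>) \<in> D m}"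
    and int_I: "integrable \<Omega> (I m)" for m
  proof -
    have eq: "I m \<omega> = indicator {\<omega>\<in>space \<Omega>. (\<lambda>t\<in>{..<n}. x m t + fst \<omega> t, snd \<omega>) \<in> D m} \<omega>" if "\<omega> \<in> space \<Omega>" for \<omega>
      using that by (auto simp: I_def indicator_def)
    show "expectation (I m) = measure \<Omega> {\<omega>\<in>space \<Omega>. (\<lambda>t\<in>{..<n}. x m t + fst \<omega> t, snd \<omega>) \<in> D m}"
      by (subst Bochner_Integration.integral_cong[OF refl eq]) (auto intro!: arg_cong2[where f=measure])
    show "integrable \<Omega> (I m)"
      by (rule integrable_const_bound[where B=1]) (auto simp: I_def)
  qed
  let ?P = "\<lambda>m. measure \<Omega> {\<omega>\<in>space \<Omega>. (\<lambda>t\<in>{..<n}. x m t + fst \<omega> t, snd \<omega>) \<in> D m}"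
  have per_m: "ln K * ?P m + expectation (\<Lambda> m) \<le> expectation (\<lambda>\<omega>. cI m \<omega> * L m \<omega>) / 2 - 1 + ln 2" if "m \<in> A" for m
  proof -
    have "ln K * ?P m + expectation (\<Lambda> m) = expectation (\<lambda>\<omega>. ln K * I m \<omega> + \<Lambda> m \<omega>)"
      using int_I int_\<Lambda> by (simp add: E_I)
    also have "\<dots> \<le> expectation (\<lambda>\<omega>. cI m \<omega> * L m \<omega> / 2 - 1 + ln 2)"
      using int_I int_\<Lambda> int_tilt[OF that] by (intro integral_mono) (auto intro: pointwise)
    also have "\<dots> = expectation (\<lambda>\<omega>. cI m \<omega> * L m \<omega>) / 2 - 1 + ln 2"
      using int_tilt[OF that] by (simp add: prob_space)
    finally show ?thesis .
  qed
  have "ln K * (\<Sum>m\<in>A. ?P m) + (\<Sum>m\<in>A. expectation (\<Lambda> m)) \<le> (\<Sum>m\<in>A. expectation (\<lambda>\<omega>. cI m \<omega> * L m \<omega>) / 2 - 1 + ln 2)"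
    using sum_mono[OF per_m] by (simp add: sum.distrib sum_distrib_left)
  also have "\<dots> = (\<Sum>m\<in>A. expectation (\<lambda>\<omega>. cI m \<omega> * L m \<omega>)) / 2 - card A + card A * ln 2"
    by (simp add: sum.distrib sum_subtractf sum_divide_distrib)
  also have "\<dots> \<le> card A * ln 2"
    using E_tilt by simp
  finally have 1: "ln K * (\<Sum>m\<in>A. ?P m) + (\<Sum>m\<in>A. expectation (\<Lambda> m)) \<le> card A * ln 2" .
  \<comment> \<open>The variance \<open>s\<close> is matched to the power bound: 1/(2s) and (s -
    1)/(2s) add up to 1/2, and only the logarithmic term survives.\<close>
  have "(\<Sum>m\<in>A. expectation (\<Lambda> m)) = card A * (n * (- ln s / 2 - 1 / (2 * s) + 1 / 2)) - (\<Sum>m\<in>A. \<Sum>t<n. (x m t)\<^sup>2) / (2 * s)"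
    unfolding E_\<Lambda> by (simp add: sum.distrib sum_subtractf sum_divide_distrib[symmetric] add_divide_distrib sum_distrib_left algebra_simps)
  also have "\<dots> \<ge> card A * (n * (- ln s / 2 - 1 / (2 * s) + 1 / 2)) - (card A * n * (s - 1)) / (2 * s)"
    using pow s0 by (intro diff_left_mono divide_right_mono) auto
  also have "card A * (n * (- ln s / 2 - 1 / (2 * s) + 1 / 2)) - (card A * n * (s - 1)) / (2 * s) = - (card A * (n / 2 * ln s))"
    using s0 by (simp add: field_simps)
  finally have "ln K * (\<Sum>m\<in>A. ?P m) \<le> card A * (n / 2 * ln s + ln 2)"
    using 1 by (simp add: algebra_simps)
  then show ?thesis
    using cA by (simp add: field_simps)
qed

text \<open>Rotation invariance of the normal law, used to top up scaled noise to unit variance. A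
  positive \<open>n\<close> keeps the index set nonempty for the characterisation of independence by
  product laws.\<close>

lemma distr_white_noise_mix:
  fixes \<alpha> \<beta> :: real and n :: nat
  assumes "0 < n" and ab: "\<alpha>\<^sup>2 + \<beta>\<^sup>2 = 1"
  shows "distr (white_noise n \<Otimes>\<^sub>M white_noise n) (white_noise n) (\<lambda>\<omega>. \<lambda>t\<in>{..<n}. \<alpha> * fst \<omega> t + \<beta> * snd \<omega> t) = white_noise n"
proof -
  have fin: "finite {..<n}" by simp
  define \<Omega> where "\<Omega> = white_noise n \<Otimes>\<^sub>M white_noise n"
  note G = indep_vars_std_gauss_pair[OF fin fin, folded \<Omega>_def]
  interpret prob_space \<Omega> by (rule G(1))
  define X where "X = case_sum (\<lambda>t (\<omega> :: (nat \<Rightarrow> real) \<times> (nat \<Rightarrow> real)). fst \<omega> t) (\<lambda>t \<omega>. snd \<omega> t)"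
  define c :: "nat + nat \<Rightarrow> real" where "c = case_sum (\<lambda>_. \<alpha>) (\<lambda>_. \<beta>)"
  define J :: "nat \<Rightarrow> (nat + nat) set" where "J t = {Inl t, Inr t}" for t
  note G = G[folded X_def]
  define L where "L t \<omega> = (\<Sum>i\<in>J t. c i * X i \<omega>)" for t \<omega>
  have L: "L t \<omega> = \<alpha> * fst \<omega> t + \<beta> * snd \<omega> t" for t \<omega>
    by (simp add: L_def J_def c_def X_def)
  have JI: "J t \<subseteq> {..<n} <+> {..<n}" if "t \<in> {..<n}" for t
    using that by (auto simp: J_def)
  have ind: "indep_vars (\<lambda>_. borel) L {..<n}"
    unfolding L_def by (rule indep_vars_linear_forms[OF G(2) JI]) (auto simp: disjoint_family_on_def J_def)
  have dist: "distributed \<Omega> lborel (L t) std_normal_density" if t: "t \<in> {..<n}" for t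
  proof -
    have s: "(\<Sum>i\<in>J t. (c i)\<^sup>2) = 1" using ab by (simp add: J_def c_def)
    have "distributed \<Omega> lborel (\<lambda>\<omega>. \<Sum>i\<in>J t. c i * X i \<omega>) (normal_density 0 (sqrt (\<Sum>i\<in>J t. (c i)\<^sup>2)))"
      by (rule normal_linear_form) (use indep_vars_subset[OF G(2) JI[OF t]] G(3) JI[OF t] s in \<open>auto simp: J_def\<close>)
    then show ?thesis by (simp add: s L_def[abs_def])
  qed
  have distr: "distr \<Omega> borel (L t) = std_gauss" if "t \<in> {..<n}" for t
    using dist[OF that] unfolding distributed_def by (metis distr_cong sets_lborel)
  have "distr \<Omega> (\<Pi>\<^sub>M t\<in>{..<n}. borel) (\<lambda>\<omega>. \<lambda>t\<in>{..<n}. L t \<omega>) = (\<Pi>\<^sub>M t\<in>{..<n}. distr \<Omega> borel (L t))"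
    using ind \<open>0 < n\<close> by (subst indep_vars_iff_distr_eq_PiM'[symmetric]) (auto simp: indep_vars_def)
  also have "\<dots> = white_noise n"
    by (intro PiM_cong) (auto simp: distr)
  also have "distr \<Omega> (\<Pi>\<^sub>M t\<in>{..<n}. borel) (\<lambda>\<omega>. \<lambda>t\<in>{..<n}. L t \<omega>) = distr \<Omega> (white_noise n) (\<lambda>\<omega>. \<lambda>t\<in>{..<n}. L t \<omega>)"
    by (intro distr_cong) (auto intro!: sets_PiM_cong)
  finally show ?thesis by (simp add: L \<Omega>_def)
qed

section \<open>Averages over independent messages\<close>

lemma sum_message_tuples_prod:
  fixes F :: "4 \<Rightarrow> nat \<Rightarrow> real"
  shows "(\<Sum>m\<in>message_tuples n R. \<Prod>i\<in>UNIV. F i (m i)) = (\<Prod>i\<in>UNIV. \<Sum>k\<in>message_set n (R $ i). F i k)"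
  unfolding message_tuples_def by (rule prod_sum_PiE[symmetric]) (auto simp: message_set)

lemma sum_message_tuples_coord:
  fixes a :: "nat \<Rightarrow> real"
  shows "(\<Sum>m\<in>message_tuples n R. a (m i))
    = card (message_tuples n R) * ((\<Sum>k\<in>message_set n (R $ i). a k) / card (message_set n (R $ i)))"
proof -
  define F where "F l k = (if l = i then a k else 1)" for l k
  have "(\<Prod>l\<in>UNIV. F l (m l)) = a (m i)" for m
    by (subst prod.remove[of _ i]) (auto simp: F_def)
  then have "(\<Sum>m\<in>message_tuples n R. a (m i)) = (\<Prod>l\<in>UNIV. \<Sum>k\<in>message_set n (R $ l). F l k)"
    by (subst sum_message_tuples_prod[symmetric]) simp
  also have "\<dots> = (\<Sum>k\<in>message_set n (R $ i). a k) * (\<Prod>l\<in>UNIV - {i}. real (card (message_set n (R $ l))))"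
    by (subst prod.remove[of _ i]) (auto simp: F_def)
  also have "real (card (message_tuples n R)) = card (message_set n (R $ i)) * (\<Prod>l\<in>UNIV - {i}. real (card (message_set n (R $ l))))"
    unfolding card_message_tuples by (subst prod.remove[of _ i]) auto
  then have "(\<Prod>l\<in>UNIV - {i}. real (card (message_set n (R $ l)))) = card (message_tuples n R) / card (message_set n (R $ i))"
    using message_set(2)[of n "R $ i"] by (simp add: field_simps)
  finally show ?thesis by simp
qed

lemma sum_message_tuples_cross:
  fixes a b :: "nat \<Rightarrow> real"
  assumes "i \<noteq> l" and "(\<Sum>k\<in>message_set n (R $ i). a k) = 0"
  shows "(\<Sum>m\<in>message_tuples n R. a (m i) * b (m l)) = 0"
proof -
  define F where "F r k = (if r = i then a k else if r = l then b k else 1)" for r k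
  have "(\<Prod>r\<in>UNIV. F r (m r)) = a (m i) * b (m l)" for m
    using assms(1) by (subst prod.remove[of _ i], simp, simp, subst prod.remove[of _ l]) (auto simp: F_def)
  then have "(\<Sum>m\<in>message_tuples n R. a (m i) * b (m l)) = (\<Prod>r\<in>UNIV. \<Sum>k\<in>message_set n (R $ r). F r k)"
    by (subst sum_message_tuples_prod[symmetric]) simp
  also have "\<dots> = 0"
    using assms(2) by (intro prod_zero) (auto intro!: exI[of _ i] simp: F_def)
  finally show ?thesis .
qed

text \<open>A variance is at most the second moment, so centring the codewords preserves the power
  constraint.\<close>

lemma centred_power_le:
  fixes f :: "nat \<Rightarrow> real"
  assumes "finite M" "M \<noteq> {}"
  defines "\<mu> \<equiv> (\<Sum>k\<in>M. f k) / card M"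
  shows "(\<Sum>k\<in>M. f k - \<mu>) = 0" "(\<Sum>k\<in>M. (f k - \<mu>)\<^sup>2) \<le> (\<Sum>k\<in>M. (f k)\<^sup>2)"
proof -
  have sum: "(\<Sum>k\<in>M. f k) = card M * \<mu>"
    using assms by (simp add: card_gt_0_iff)
  then show "(\<Sum>k\<in>M. f k - \<mu>) = 0" by (simp add: sum_subtractf)
  have "(\<Sum>k\<in>M. (f k - \<mu>)\<^sup>2) = (\<Sum>k\<in>M. (f k)\<^sup>2) - 2 * \<mu> * (\<Sum>k\<in>M. f k) + card M * \<mu>\<^sup>2"
    by (simp add: power2_diff sum.distrib sum_subtractf sum_distrib_left sum_distrib_right mult_ac)
  also have "\<dots> = (\<Sum>k\<in>M. (f k)\<^sup>2) - card M * \<mu>\<^sup>2"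
    unfolding sum by (simp add: power2_eq_square algebra_simps)
  finally show "(\<Sum>k\<in>M. (f k - \<mu>)\<^sup>2) \<le> (\<Sum>k\<in>M. (f k)\<^sup>2)" by simp
qed

text \<open>Variances of independent summands add. Without centring, the cross terms of different
  transmitters would survive and the received power could exceed the sum of the individual
  ones.\<close>

lemma sum_message_tuples_centred_square:
  fixes a :: "4 \<Rightarrow> nat \<Rightarrow> real"
  assumes zero: "\<And>i. i \<in> T \<Longrightarrow> (\<Sum>k\<in>message_set n (R $ i). a i k) = 0"
  shows "(\<Sum>m\<in>message_tuples n R. (\<Sum>i\<in>T. a i (m i))\<^sup>2)
    = card (message_tuples n R) * (\<Sum>i\<in>T. (\<Sum>k\<in>message_set n (R $ i). (a i k)\<^sup>2) / card (message_set n (R $ i)))"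
proof -
  have "(\<Sum>m\<in>message_tuples n R. (\<Sum>i\<in>T. a i (m i))\<^sup>2)
      = (\<Sum>m\<in>message_tuples n R. \<Sum>i\<in>T. \<Sum>l\<in>T. a i (m i) * a l (m l))"
    by (simp add: power2_eq_square sum_product)
  also have "\<dots> = (\<Sum>i\<in>T. \<Sum>l\<in>T. \<Sum>m\<in>message_tuples n R. a i (m i) * a l (m l))"
    by (subst sum.swap, rule sum.cong[OF refl], rule sum.swap)
  also have "\<dots> = (\<Sum>i\<in>T. \<Sum>l\<in>T. if l = i then \<Sum>m\<in>message_tuples n R. (a i (m i))\<^sup>2 else 0)"
    by (intro sum.cong refl) (auto simp: power2_eq_square intro!: sum_message_tuples_cross zero)
  also have "\<dots> = (\<Sum>i\<in>T. card (message_tuples n R) * ((\<Sum>k\<in>message_set n (R $ i). (a i k)\<^sup>2) / card (message_set n (R $ i))))"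
    using sum_message_tuples_coord[of "\<lambda>k. (a _ k)\<^sup>2"] by (simp add: finite_subset[OF subset_UNIV])
  finally show ?thesis by (simp add: sum_distrib_left)
qed

section \<open>From a code to a bound on its sum rates\<close>

text \<open>Receiver \<open>j\<close> is told all messages outside \<open>T\<close>, in particular
  that of the interferer \<open>d\<close>. It decodes its own messages, then imitates receiver
  \<open>j'\<close> to decode that of the interferer \<open>c\<close>. Each stage fails with
  probability at most that of an error of the code, whence the factor 2, and
  \<open>gaussian_fano\<close> applies to this decoder.\<close>

lemma code_sum_rate_le:
  assumes code: "is_code P n R f g" and n: "0 < n" and P: "\<And>i. 0 \<le> P i"
    and own: "\<And>i. i \<noteq> c \<Longrightarrow> i \<noteq> d \<Longrightarrow> intended_receiver i = j"
    and c: "intended_receiver c = j'" "h c j \<noteq> 0" "(h c j')\<^sup>2 \<le> (h c j)\<^sup>2" and cd: "c \<noteq> d"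
    and T: "d \<notin> T"
  shows "(1 - 2 * error_prob h n R f g) * ln (\<Prod>i\<in>T. card (message_set n (R $ i)))
    \<le> n / 2 * ln (1 + (\<Sum>i\<in>T. (h i j)\<^sup>2 * P i)) + ln 2"
proof -
  let ?A = "message_tuples n R"
  let ?M = "\<lambda>i. message_set n (R $ i)"
  define \<Omega> where "\<Omega> = white_noise n \<Otimes>\<^sub>M white_noise n"
  have fin: "finite {..<n}" by simp
  interpret prob_space \<Omega>
    using indep_vars_std_gauss_pair(1)[OF fin fin] by (simp add: \<Omega>_def)
  interpret Z: prob_space "noise_space n" by (rule prob_space_noise_space)
  \<comment> \<open>Scaling by \<open>\<alpha>\<close> turns the gain of \<open>c\<close> at
    \<open>j\<close> into its gain at \<open>j'\<close>. The noise is scaled to variance at most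
    one, and \<open>\<beta>\<close> is the amplitude of the fresh noise that fills the gap.\<close>
  define \<alpha> where "\<alpha> = h c j' / h c j"
  define \<beta> where "\<beta> = sqrt (1 - \<alpha>\<^sup>2)"
  have "\<alpha>\<^sup>2 \<le> 1" using c(2,3) by (simp add: \<alpha>_def power_divide)
  then have ab: "\<alpha>\<^sup>2 + \<beta>\<^sup>2 = 1" by (simp add: \<beta>_def)
  \<comment> \<open>The mean over the messages does not depend on the message sent, so it can be
    shifted from the signal \<open>x\<close> into the known offset \<open>off\<close>.\<close>
  define \<mu> where "\<mu> i t = (\<Sum>k\<in>?M i. f i k t) / card (?M i)" for i t
  define x where "x m t = (\<Sum>i\<in>T. h i j * (f i (m i) t - \<mu> i t))" for m t
  \<comment> \<open>Depends on \<open>m\<close> only outside \<open>T\<close>, that is, on side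
    information.\<close>
  define off where "off m t = (\<Sum>i\<in>-T. h i j * f i (m i) t) + (\<Sum>i\<in>T. h i j * \<mu> i t)" for m t
  have x_off: "x m t + off m t = (\<Sum>i\<in>UNIV. h i j * f i (m i) t)" for m t
  proof -
    have "(\<Sum>i\<in>UNIV. h i j * f i (m i) t) = (\<Sum>i\<in>T. h i j * f i (m i) t) + (\<Sum>i\<in>-T. h i j * f i (m i) t)"
      by (subst sum.union_disjoint[symmetric]) (auto intro!: sum.cong)
    then show ?thesis
      by (simp add: x_def off_def sum_subtractf right_diff_distrib)
  qed
  define Y where "Y m y = (\<lambda>t\<in>{..<n}. y t + off m t)" for m and y :: "nat \<Rightarrow> real"
  \<comment> \<open>The simulated output of receiver \<open>j'\<close>: everything except the
    contribution of \<open>c\<close> is removed from the output of \<open>j\<close>, the rest is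
    scaled and given extra noise, and the signals as seen at \<open>j'\<close> are put back.\<close>
  define E where "E m y v = (\<lambda>t\<in>{..<n}. (\<Sum>i\<in>-{c}. h i j' * f i (m i) t)
      + \<alpha> * (y t + off m t - (\<Sum>i\<in>-{c}. h i j * f i (m i) t)) + \<beta> * v t)" for m and y v :: "nat \<Rightarrow> real"
  \<comment> \<open>The event that the two-stage decoder with side information \<open>m\<close>
    outside \<open>T\<close> returns \<open>m\<close>. Inserting \<open>m\<close> itself as the
    result of the first stage is legitimate because the first conjunct confirms it.\<close>
  define D where "D m = {p \<in> space (block_space n \<Otimes>\<^sub>M block_space n).
      (\<forall>i. i \<noteq> c \<longrightarrow> i \<noteq> d \<longrightarrow> g i (Y m (fst p)) = m i) \<and> g c (E m (fst p) (snd p)) = m c}" for m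
  have g[measurable]: "g i \<in> block_space n \<rightarrow>\<^sub>M count_space (?M i)" for i
    using code by (simp add: is_code_def)
  have [measurable]: "(\<lambda>p. Y m (fst p)) \<in> block_space n \<Otimes>\<^sub>M block_space n \<rightarrow>\<^sub>M block_space n"
    "(\<lambda>p. E m (fst p) (snd p)) \<in> block_space n \<Otimes>\<^sub>M block_space n \<rightarrow>\<^sub>M block_space n" for m
    unfolding Y_def E_def by (intro measurable_restrict; measurable)+
  have D_sets: "D m \<in> sets (block_space n \<Otimes>\<^sub>M block_space n)" for m
    unfolding D_def by measurable
  define K where "K = (\<Prod>i\<in>T. card (?M i))"
  have K: "0 < K" unfolding K_def by (intro prod_pos ballI message_set)
  \<comment> \<open>For each choice of the side information at most one tuple is decoded, so the
    decision regions overlap at most as often as there are such choices.\<close>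
  have count: "real K * card {m\<in>?A. p \<in> D m} \<le> card ?A" for p
  proof -
    have inj: "inj_on (\<lambda>m. restrict m (-T)) {m\<in>?A. p \<in> D m}"
    proof (rule inj_onI)
      fix m m' assume m: "m \<in> {m\<in>?A. p \<in> D m}" and m': "m' \<in> {m\<in>?A. p \<in> D m}"
        and eq: "restrict m (-T) = restrict m' (-T)"
      have agree: "m i = m' i" if "i \<notin> T" for i
        using fun_cong[OF eq, of i] that by simp
      then have "off m = off m'" by (auto simp: off_def fun_eq_iff intro!: sum.cong)
      then have "Y m = Y m'" by (simp add: Y_def fun_eq_iff)
      \<comment> \<open>The order of decoding matters: \<open>E m\<close> and \<open>E m'\<close>
        are known to agree only after all messages except that of \<open>c\<close> do.\<close>
      then have "m i = m' i" if "i \<noteq> c" for i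
        using that m m' agree T by (cases "i = d") (auto simp: D_def)
      moreover from this have "(\<Sum>i\<in>-{c}. h i l * f i (m i) t) = (\<Sum>i\<in>-{c}. h i l * f i (m' i) t)" for l t
        by (intro sum.cong) auto
      then have "E m = E m'"
        using \<open>off m = off m'\<close> by (simp add: E_def fun_eq_iff)
      then have "m c = m' c" using m m' by (auto simp: D_def)
      ultimately show "m = m'" by (metis ext)
    qed
    have "card {m\<in>?A. p \<in> D m} \<le> card (\<Pi>\<^sub>E i\<in>-T. ?M i)"
      by (rule card_inj_on_le[OF inj]) (auto intro!: finite_PiE message_set dest: message_tuplesD)
    also have "\<dots> = (\<Prod>i\<in>-T. card (?M i))" by (simp add: card_PiE)
    finally have "K * card {m\<in>?A. p \<in> D m} \<le> K * (\<Prod>i\<in>-T. card (?M i))" by simp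
    also have "\<dots> = card ?A"
      unfolding K_def card_message_tuples by (subst prod.union_disjoint[symmetric]) (auto intro!: prod.cong)
    finally have "real (K * card {m\<in>?A. p \<in> D m}) \<le> real (card ?A)" by (rule of_nat_mono)
    then show ?thesis by simp
  qed
  define s where "s = 1 + (\<Sum>i\<in>T. (h i j)\<^sup>2 * P i)"
  have s: "1 \<le> s" using P by (simp add: s_def sum_nonneg)
  have pow: "(\<Sum>m\<in>?A. \<Sum>t<n. (x m t)\<^sup>2) \<le> card ?A * n * (s - 1)"
  proof -
    have "(\<Sum>m\<in>?A. (x m t)\<^sup>2) \<le> card ?A * (\<Sum>i\<in>T. (h i j)\<^sup>2 * ((\<Sum>k\<in>?M i. (f i k t)\<^sup>2) / card (?M i)))" for t
    proof -
      have zero: "(\<Sum>k\<in>?M i. h i j * (f i k t - \<mu> i t)) = 0" for i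
        using centred_power_le(1)[where f="\<lambda>k. f i k t", OF message_set(1,3)]
        by (simp add: \<mu>_def sum_distrib_left[symmetric])
      have var: "(\<Sum>k\<in>?M i. (f i k t - \<mu> i t)\<^sup>2) \<le> (\<Sum>k\<in>?M i. (f i k t)\<^sup>2)" for i
        unfolding \<mu>_def by (rule centred_power_le(2)[OF message_set(1,3)])
      have "(\<Sum>m\<in>?A. (x m t)\<^sup>2) = card ?A * (\<Sum>i\<in>T. (\<Sum>k\<in>?M i. (h i j * (f i k t - \<mu> i t))\<^sup>2) / card (?M i))"
        unfolding x_def by (rule sum_message_tuples_centred_square[OF zero])
      also have "\<dots> \<le> card ?A * (\<Sum>i\<in>T. (h i j)\<^sup>2 * ((\<Sum>k\<in>?M i. (f i k t)\<^sup>2) / card (?M i)))"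
        using var by (intro mult_left_mono sum_mono)
          (auto simp: power_mult_distrib sum_distrib_left[symmetric] intro!: divide_right_mono mult_left_mono)
      finally show ?thesis .
    qed
    then have "(\<Sum>t<n. \<Sum>m\<in>?A. (x m t)\<^sup>2) \<le> (\<Sum>t<n. card ?A * (\<Sum>i\<in>T. (h i j)\<^sup>2 * ((\<Sum>k\<in>?M i. (f i k t)\<^sup>2) / card (?M i))))"
      by (rule sum_mono)
    also have "\<dots> = card ?A * (\<Sum>i\<in>T. (h i j)\<^sup>2 * (\<Sum>t<n. (\<Sum>k\<in>?M i. (f i k t)\<^sup>2) / card (?M i)))"
      by (subst sum_distrib_left[symmetric], subst sum.swap) (simp add: sum_distrib_left)
    also have "\<dots> \<le> card ?A * (\<Sum>i\<in>T. (h i j)\<^sup>2 * (n * P i))"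
    proof (intro mult_left_mono sum_mono)
      fix i
      have avg: "(\<integral>\<omega>. (f i (fst \<omega> i) t)\<^sup>2 \<partial>sample_space n R) = (\<Sum>k\<in>?M i. (f i k t)\<^sup>2) / card (?M i)" for t
        by (rule integral_sample_space_message)
      have "1 / n * (\<Sum>t<n. \<integral>\<omega>. (f i (fst \<omega> i) t)\<^sup>2 \<partial>sample_space n R) \<le> P i"
        using code by (simp add: is_code_def)
      then have "1 / n * (\<Sum>t<n. (\<Sum>k\<in>?M i. (f i k t)\<^sup>2) / card (?M i)) \<le> P i"
        by (simp only: avg)
      then show "(\<Sum>t<n. (\<Sum>k\<in>?M i. (f i k t)\<^sup>2) / card (?M i)) \<le> n * P i"
        using n by (simp add: field_simps)
    qed auto
    also have "\<dots> = card ?A * n * (s - 1)"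
      by (simp add: s_def sum_distrib_left mult_ac)
    finally show ?thesis by (subst sum.swap)
  qed
  let ?S = "\<lambda>m. {\<omega>\<in>space \<Omega>. (\<lambda>t\<in>{..<n}. x m t + fst \<omega> t, snd \<omega>) \<in> D m}"
  let ?err = "\<lambda>m. measure (noise_space n) {z \<in> space (noise_space n).
      \<exists>i. g i (received h n f (intended_receiver i) m (z (intended_receiver i))) \<noteq> m i}"
  have fano: "(\<Sum>m\<in>?A. measure \<Omega> (?S m)) / card ?A * ln K \<le> n / 2 * ln s + ln 2"
    unfolding \<Omega>_def by (rule gaussian_fano[OF message_tuples(1,3) _ s D_sets count pow]) (use K in simp)
  \<comment> \<open>\<open>?B1\<close> is failure on the own messages, \<open>?B2\<close> failure on
    the simulated output. The noise driving each has the law of the true one, so each is at most as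
    likely as an error of the code, and a union bound suffices although the two are
    dependent.\<close>
  have correct: "1 - 2 * ?err m \<le> measure \<Omega> (?S m)" for m
  proof -
    let ?mix = "\<lambda>\<omega>. \<lambda>t\<in>{..<n}. \<alpha> * fst \<omega> t + \<beta> * snd \<omega> t"
    let ?B1 = "{\<omega>\<in>space \<Omega>. \<exists>i. i \<noteq> c \<and> i \<noteq> d \<and> g i (received h n f j m (fst \<omega>)) \<noteq> m i}"
    let ?B2 = "{\<omega>\<in>space \<Omega>. g c (received h n f j' m (?mix \<omega>)) \<noteq> m c}"
    have [measurable]: "Measurable.pred (white_noise n) (\<lambda>z. g i (received h n f l m z) \<noteq> k)" for i l k
      by (rule pred_decoder_eq[OF g])
    have mix[measurable]: "?mix \<in> \<Omega> \<rightarrow>\<^sub>M white_noise n"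
      unfolding \<Omega>_def by (intro measurable_restrict) simp
    have noise_err[measurable]: "{z \<in> space (noise_space n).
      \<exists>i. g i (received h n f (intended_receiver i) m (z (intended_receiver i))) \<noteq> m i} \<in> sets (noise_space n)"
      by measurable
    have fst[measurable]: "fst \<in> \<Omega> \<rightarrow>\<^sub>M white_noise n" by (simp add: \<Omega>_def)
    have B1_sets: "?B1 \<in> events" by measurable
    have B2_sets: "?B2 \<in> events" by measurable
    have "measure \<Omega> ?B1 = measure (distr \<Omega> (white_noise n) fst) {z\<in>space (white_noise n). \<exists>i. i \<noteq> c \<and> i \<noteq> d \<and> g i (received h n f j m z) \<noteq> m i}"
      by (subst measure_distr) (auto intro!: arg_cong2[where f=measure] dest: measurable_space[OF fst])
    also have "distr \<Omega> (white_noise n) fst = white_noise n"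
      unfolding \<Omega>_def by (rule prob_space.distr_pair_fst[OF prob_space_white_noise])
    also have "measure (white_noise n) {z\<in>space (white_noise n). \<exists>i. i \<noteq> c \<and> i \<noteq> d \<and> g i (received h n f j m z) \<noteq> m i}
      = measure (noise_space n) {z\<in>space (noise_space n). \<exists>i. i \<noteq> c \<and> i \<noteq> d \<and> g i (received h n f j m (z j)) \<noteq> m i}"
      by (rule measure_noise_component[symmetric]) measurable
    also have "\<dots> \<le> ?err m"
      by (intro Z.finite_measure_mono noise_err) (use own in auto)
    finally have B1: "measure \<Omega> ?B1 \<le> ?err m" .
    have "measure \<Omega> ?B2 = measure (distr \<Omega> (white_noise n) ?mix) {z\<in>space (white_noise n). g c (received h n f j' m z) \<noteq> m c}"
      by (subst measure_distr) (auto intro!: arg_cong2[where f=measure] simp: space_PiM)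
    also have "distr \<Omega> (white_noise n) ?mix = white_noise n"
      unfolding \<Omega>_def by (rule distr_white_noise_mix[OF n ab])
    also have "measure (white_noise n) {z\<in>space (white_noise n). g c (received h n f j' m z) \<noteq> m c}
      = measure (noise_space n) {z\<in>space (noise_space n). g c (received h n f j' m (z j')) \<noteq> m c}"
      by (rule measure_noise_component[symmetric]) measurable
    also have "\<dots> \<le> ?err m"
      by (intro Z.finite_measure_mono noise_err) (use c(1) in auto)
    finally have B2: "measure \<Omega> ?B2 \<le> ?err m" .
    have Y: "Y m (\<lambda>t\<in>{..<n}. x m t + z t) = received h n f j m z" for z
      using x_off[of m] by (auto simp: Y_def received_def fun_eq_iff add_ac)
    have E: "E m (\<lambda>t\<in>{..<n}. x m t + fst \<omega> t) (snd \<omega>) = received h n f j' m (?mix \<omega>)" for \<omega>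
    proof -
      have split: "(\<Sum>i\<in>UNIV. h i l * f i (m i) t) = h c l * f c (m c) t + (\<Sum>i\<in>-{c}. h i l * f i (m i) t)" for l t
        by (subst sum.remove[of _ c]) (auto simp: Compl_eq_Diff_UNIV)
      have diff: "x m t + fst \<omega> t + off m t - (\<Sum>i\<in>-{c}. h i j * f i (m i) t) = h c j * f c (m c) t + fst \<omega> t" for t
        using x_off[of m t] split[of j t] by simp
      have key: "\<alpha> * (x m t + fst \<omega> t + off m t - (\<Sum>i\<in>-{c}. h i j * f i (m i) t)) = h c j' * f c (m c) t + \<alpha> * fst \<omega> t" for t
        unfolding diff using c(2) by (simp add: \<alpha>_def distrib_left)
      show ?thesis
        unfolding E_def received_def by (rule restrict_ext) (simp add: split key)
    qed
    have "space \<Omega> - (?B1 \<union> ?B2) \<subseteq> ?S m"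
      by (auto simp: D_def Y E \<Omega>_def space_pair_measure space_PiM)
    moreover have S_sets: "?S m \<in> events"
    proof -
      have [measurable]: "(\<lambda>\<omega>. (\<lambda>t\<in>{..<n}. x m t + fst \<omega> t, snd \<omega>)) \<in> \<Omega> \<rightarrow>\<^sub>M block_space n \<Otimes>\<^sub>M block_space n"
        unfolding \<Omega>_def by (intro measurable_Pair measurable_restrict)
          (auto intro!: measurable_compose[OF measurable_snd] measurable_ident_sets sets_PiM_cong)
      show ?thesis using D_sets by measurable
    qed
    ultimately have "measure \<Omega> (space \<Omega> - (?B1 \<union> ?B2)) \<le> measure \<Omega> (?S m)"
      by (intro finite_measure_mono)
    moreover have "measure \<Omega> (space \<Omega> - (?B1 \<union> ?B2)) = 1 - measure \<Omega> (?B1 \<union> ?B2)"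
      using B1_sets B2_sets by (intro prob_compl) auto
    moreover have "measure \<Omega> (?B1 \<union> ?B2) \<le> measure \<Omega> ?B1 + measure \<Omega> ?B2"
      using B1_sets B2_sets by (intro measure_subadditive) auto
    ultimately show ?thesis using B1 B2 by linarith
  qed
  have "1 - 2 * error_prob h n R f g = (\<Sum>m\<in>?A. 1 - 2 * ?err m) / card ?A"
    using message_tuples(2)[of n R]
    by (simp add: error_prob_eq[OF g] sum_subtractf sum_distrib_left[symmetric] diff_divide_distrib)
  also have "\<dots> \<le> (\<Sum>m\<in>?A. measure \<Omega> (?S m)) / card ?A"
    by (intro divide_right_mono sum_mono correct) simp
  finally have "(1 - 2 * error_prob h n R f g) * ln K \<le> (\<Sum>m\<in>?A. measure \<Omega> (?S m)) / card ?A * ln K"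
    using K by (intro mult_right_mono) auto
  with fano show ?thesis by (simp add: K_def s_def)
qed

lemma achievable_sum_rate_le:
  assumes ach: "achievable P h R" and P: "\<And>i. 0 \<le> P i"
    and own: "\<And>i. i \<noteq> c \<Longrightarrow> i \<noteq> d \<Longrightarrow> intended_receiver i = j"
    and c: "intended_receiver c = j'" "h c j \<noteq> 0" "(h c j')\<^sup>2 \<le> (h c j)\<^sup>2" and cd: "c \<noteq> d"
    and T: "d \<notin> T"
  shows "(\<Sum>i\<in>T. R $ i) \<le> 1 / 2 * log 2 (1 + (\<Sum>i\<in>T. (h i j)\<^sup>2 * P i))"
proof -
  obtain f g where code: "\<And>n. 1 \<le> n \<Longrightarrow> is_code P n R (f n) (g n)"
    and err: "(\<lambda>n. error_prob h n R (f n) (g n)) \<longlonglongrightarrow> 0"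
    using ach by (auto simp: achievable_def)
  let ?e = "\<lambda>n. error_prob h n R (f n) (g n)"
  let ?s = "1 + (\<Sum>i\<in>T. (h i j)\<^sup>2 * P i)"
  have s: "0 < ?s" using P by (intro add_pos_nonneg sum_nonneg) auto
  \<comment> \<open>Keeps the factor \<open>1 - 2 * ?e n\<close> positive, so that it may multiply
    the lower bound on the number of messages.\<close>
  have "eventually (\<lambda>n. ?e n < 1 / 2) sequentially"
    using order_tendstoD(2)[OF err, of "1/2"] by simp
  then have "eventually (\<lambda>n. (1 - 2 * ?e n) * ((\<Sum>i\<in>T. R $ i) * ln 2) \<le> 1 / 2 * ln ?s + ln 2 / n) sequentially"
    using eventually_gt_at_top[of 0]
  proof eventually_elim
    case (elim n)
    have "(\<Sum>i\<in>T. n * (R $ i) * ln 2) \<le> (\<Sum>i\<in>T. ln (card (message_set n (R $ i))))"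
    proof (rule sum_mono)
      fix i
      have "n * (R $ i) * ln 2 = ln (2 powr (n * (R $ i)))" by (simp add: ln_powr)
      also have "\<dots> \<le> ln (card (message_set n (R $ i)))"
        using card_message_set_ge[of n "R $ i"] by (intro ln_mono) auto
      finally show "n * (R $ i) * ln 2 \<le> ln (card (message_set n (R $ i)))" .
    qed
    also have "\<dots> = ln (\<Prod>i\<in>T. card (message_set n (R $ i)))"
      using message_set(2) by (subst ln_prod[symmetric]) (auto simp: finite_subset[OF subset_UNIV] card_gt_0_iff)
    finally have "(1 - 2 * ?e n) * (\<Sum>i\<in>T. n * (R $ i) * ln 2) \<le> (1 - 2 * ?e n) * ln (\<Prod>i\<in>T. card (message_set n (R $ i)))"
      using elim by (intro mult_left_mono) auto
    also have "\<dots> \<le> n / 2 * ln ?s + ln 2"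
      by (rule code_sum_rate_le[where c=c and d=d and j=j and j'=j']) (use assms code elim in auto)
    finally have "n * ((1 - 2 * ?e n) * ((\<Sum>i\<in>T. R $ i) * ln 2)) \<le> n * (1 / 2 * ln ?s + ln 2 / n)"
      using elim by (simp add: sum_distrib_left sum_distrib_right mult_ac distrib_left)
    then show ?case using elim by simp
  qed
  moreover have "(\<lambda>n. (1 - 2 * ?e n) * ((\<Sum>i\<in>T. R $ i) * ln 2)) \<longlonglongrightarrow> (1 - 2 * 0) * ((\<Sum>i\<in>T. R $ i) * ln 2)"
    by (intro tendsto_intros err)
  moreover have "(\<lambda>n. 1 / 2 * ln ?s + ln 2 / n) \<longlonglongrightarrow> 1 / 2 * ln ?s + 0"
    by (intro tendsto_intros lim_const_over_n)
  ultimately have "(1 - 2 * 0) * ((\<Sum>i\<in>T. R $ i) * ln 2) \<le> 1 / 2 * ln ?s + 0"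
    by (intro tendsto_le[OF sequentially_bot]) auto
  then show ?thesis by (simp add: log_def field_simps)
qed

section \<open>Random codebooks\<close>

text \<open>The set of plausible tuples is measurable as a map into a finite discrete space, so any
  choice made from it is measurable; \<open>m0\<close> is the default when nothing is plausible.
  Each decoder takes its own coordinate of the joint decision.\<close>

lemma decoder_exists:
  fixes plaus :: "2 \<Rightarrow> (4 \<Rightarrow> nat) \<Rightarrow> (nat \<Rightarrow> real) \<Rightarrow> bool"
  assumes plaus[measurable]: "\<And>j m. Measurable.pred (block_space n) (plaus j m)"
  shows "\<exists>g. (\<forall>i. g i \<in> block_space n \<rightarrow>\<^sub>M count_space (message_set n (R $ i))) \<and>
    (\<forall>i m y. m \<in> message_tuples n R \<longrightarrow>
      (\<forall>m'\<in>message_tuples n R. plaus (intended_receiver i) m' y \<longleftrightarrow> m' = m) \<longrightarrow> g i y = m i)"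
proof -
  let ?A = "message_tuples n R"
  obtain m0 where m0: "m0 \<in> ?A" using message_tuples(3) by blast
  define pick where "pick S = (if S = {} then m0 else SOME m. m \<in> S)" for S :: "(4 \<Rightarrow> nat) set"
  define pl where "pl j y = {m\<in>?A. plaus j m y}" for j y
  define g where "g i y = pick (pl (intended_receiver i) y) i" for i y
  have pick: "pick S \<in> ?A" if "S \<subseteq> ?A" for S
    using m0 that some_in_eq[of S] by (auto simp: pick_def)
  have pl[measurable]: "pl j \<in> block_space n \<rightarrow>\<^sub>M count_space (Pow ?A)" for j
  proof (subst measurable_count_space_eq2)
    show "finite (Pow ?A)" using message_tuples(1) by simp
    show "pl j \<in> space (block_space n) \<rightarrow> Pow ?A \<and>
      (\<forall>S\<in>Pow ?A. pl j -` {S} \<inter> space (block_space n) \<in> sets (block_space n))"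
    proof (intro conjI ballI)
      fix S assume "S \<in> Pow ?A"
      then have "pl j y = S \<longleftrightarrow> (\<forall>m\<in>?A. plaus j m y \<longleftrightarrow> m \<in> S)" for y
        unfolding pl_def by blast
      then have "pl j -` {S} \<inter> space (block_space n) = {y\<in>space (block_space n). \<forall>m\<in>?A. plaus j m y \<longleftrightarrow> m \<in> S}"
        by auto
      also have "\<dots> \<in> sets (block_space n)"
        using message_tuples(1)[of n R] by (intro sets.sets_Collect_finite_All) (auto intro: measurable_sets_Collect)
      finally show "pl j -` {S} \<inter> space (block_space n) \<in> sets (block_space n)" .
    qed (auto simp: pl_def)
  qed
  have "(\<lambda>S. pick S i) \<in> count_space (Pow ?A) \<rightarrow>\<^sub>M count_space (message_set n (R $ i))" for i
    using pick by (auto intro: message_tuplesD)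
  then have "g i \<in> block_space n \<rightarrow>\<^sub>M count_space (message_set n (R $ i))" for i
    unfolding g_def by (intro measurable_compose[OF pl])
  moreover have "g i y = m i" if "m \<in> ?A" "\<forall>m'\<in>?A. plaus (intended_receiver i) m' y \<longleftrightarrow> m' = m" for i m y
  proof -
    have "pl (intended_receiver i) y = {m}" using that by (auto simp: pl_def)
    then show ?thesis by (simp add: g_def pick_def)
  qed
  ultimately show ?thesis by blast
qed

text \<open>An average cannot lie below all the values averaged. This fixes a codebook out of the
  random ensemble.\<close>

lemma exists_section_le:
  fixes \<phi> :: "'a \<times> 'b \<Rightarrow> real"
  assumes "prob_space M" "prob_space N" and int: "integrable (M \<Otimes>\<^sub>M N) \<phi>"
    and le: "(\<integral>\<omega>. \<phi> \<omega> \<partial>(M \<Otimes>\<^sub>M N)) < \<epsilon>"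
  shows "\<exists>x\<in>space M. (\<integral>z. \<phi> (x, z) \<partial>N) < \<epsilon>"
proof (rule ccontr)
  assume neg: "\<not> (\<exists>x\<in>space M. (\<integral>z. \<phi> (x, z) \<partial>N) < \<epsilon>)"
  interpret M: prob_space M by fact
  interpret N: prob_space N by fact
  interpret pair_prob_space M N ..
  have "\<epsilon> \<le> (\<integral>x. (\<integral>z. \<phi> (x, z) \<partial>N) \<partial>M)"
    using neg by (intro M.integral_ge_const integrable_fst' int AE_I2) auto
  also have "\<dots> = (\<integral>\<omega>. \<phi> \<omega> \<partial>(M \<Otimes>\<^sub>M N))" by (rule integral_fst'[OF int])
  finally show False using le by simp
qed

text \<open>The true message is excluded in each coordinate of \<open>T\<close>. Hence the bound is
  zero as soon as one of them has a single message, which later takes care of zero rates.\<close>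

lemma card_differ_exactly:
  assumes "m \<in> message_tuples n R"
  shows "real (card {m'\<in>message_tuples n R. {i. m i \<noteq> m' i} = T}) \<le> (\<Prod>i\<in>T. real (card (message_set n (R $ i))) - 1)"
proof -
  let ?M = "\<lambda>i. message_set n (R $ i)"
  have "{m'\<in>message_tuples n R. {i. m i \<noteq> m' i} = T} \<subseteq> (\<Pi>\<^sub>E i\<in>UNIV. if i \<in> T then ?M i - {m i} else {m i})"
    by (auto simp: message_tuples_def PiE_iff)
  then have "card {m'\<in>message_tuples n R. {i. m i \<noteq> m' i} = T} \<le> card (\<Pi>\<^sub>E i\<in>UNIV. if i \<in> T then ?M i - {m i} else {m i})"
    by (rule card_mono[rotated]) (auto intro!: finite_PiE message_set)
  also have "\<dots> = (\<Prod>i\<in>UNIV. if i \<in> T then card (?M i) - 1 else 1)"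
    using assms by (subst card_PiE) (auto intro!: prod.cong simp: message_tuplesD card_Diff_singleton)
  also have "\<dots> = (\<Prod>i\<in>T. card (?M i) - 1)"
    by (simp add: prod.If_cases)
  finally have "real (card {m'\<in>message_tuples n R. {i. m i \<noteq> m' i} = T}) \<le> real (\<Prod>i\<in>T. card (?M i) - 1)"
    by (rule of_nat_mono)
  also have "\<dots> = (\<Prod>i\<in>T. real (card (?M i)) - 1)"
    using message_set(2)[of n] by (simp add: of_nat_diff Suc_le_eq)
  finally show ?thesis .
qed

section \<open>The Gaussian ensemble and its typicality test\<close>

text \<open>The codeword of message \<open>k\<close> of transmitter \<open>i\<close> is
  \<open>a i * G (i, k, t)\<close> with \<open>G\<close> standard normal. Keeping the amplitude
  outside the random variable covers \<open>a i = 0\<close> too.\<close>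

locale random_codebook =
  fixes n :: nat and R :: "real ^ 4" and h :: "4 \<Rightarrow> 2 \<Rightarrow> real" and a :: "4 \<Rightarrow> real" and \<delta> :: real
  assumes n: "0 < n" and \<delta>: "0 < \<delta>"
begin

abbreviation "M i \<equiv> message_set n (R $ i)"
abbreviation "A \<equiv> message_tuples n R"

definition "code_index = {(i, k, t). k \<in> M i \<and> t < n}"

abbreviation "codebook \<equiv> \<Pi>\<^sub>M q\<in>code_index. std_gauss"
abbreviation "\<Omega> \<equiv> codebook \<Otimes>\<^sub>M white_noise n"

definition signal :: "2 \<Rightarrow> 4 set \<Rightarrow> (4 \<Rightarrow> nat) \<Rightarrow> (4 \<times> nat \<times> nat \<Rightarrow> real) \<Rightarrow> nat \<Rightarrow> real" where
  "signal j T m G t = (\<Sum>i\<in>T. h i j * a i * G (i, m i, t))"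

text \<open>The variance of one sample of \<open>signal j T\<close>, so
  \<open>1 + rx_power j T\<close> is that of a received sample from which the signals outside
  \<open>T\<close> have been subtracted.\<close>

definition rx_power :: "2 \<Rightarrow> 4 set \<Rightarrow> real" where
  "rx_power j T = (\<Sum>i\<in>T. (h i j * a i)\<^sup>2)"

text \<open>
  The second condition keeps \<open>y\<close> minus the signals outside \<open>T\<close> typical. Together with the first it
  forces the likelihood ratio of \<open>m\<close> against a message tuple that is wrong exactly on \<open>T\<close> to be
  exponentially large, which is what \<open>prob_wrong_plausible\<close> exploits.
\<close>

definition plausible :: "2 \<Rightarrow> (4 \<times> nat \<times> nat \<Rightarrow> real) \<Rightarrow> (4 \<Rightarrow> nat) \<Rightarrow> (nat \<Rightarrow> real) \<Rightarrow> bool" where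
  "plausible j G m y \<longleftrightarrow> (\<Sum>t<n. (y t - signal j UNIV m G t)\<^sup>2) \<le> n * (1 + \<delta>) \<and>
     (\<forall>T. n * (1 - \<delta>) * (1 + rx_power j T) \<le> (\<Sum>t<n. (y t - signal j (-T) m G t)\<^sup>2))"

definition chan_out :: "2 \<Rightarrow> (4 \<Rightarrow> nat) \<Rightarrow> (4 \<times> nat \<times> nat \<Rightarrow> real) \<Rightarrow> (nat \<Rightarrow> real) \<Rightarrow> nat \<Rightarrow> real" where
  "chan_out j m G z = (\<lambda>t\<in>{..<n}. signal j UNIV m G t + z t)"

definition X :: "(4 \<times> nat \<times> nat) + nat \<Rightarrow> (4 \<times> nat \<times> nat \<Rightarrow> real) \<times> (nat \<Rightarrow> real) \<Rightarrow> real" where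
  "X = case_sum (\<lambda>q \<omega>. fst \<omega> q) (\<lambda>t \<omega>. snd \<omega> t)"

definition weight :: "2 \<Rightarrow> (4 \<times> nat \<times> nat) + nat \<Rightarrow> real" where
  "weight j = case_sum (\<lambda>(i, _). h i j * a i) (\<lambda>_. 1)"

definition code_support :: "4 set \<Rightarrow> (4 \<Rightarrow> nat) \<Rightarrow> nat \<Rightarrow> ((4 \<times> nat \<times> nat) + nat) set" where
  "code_support T m t = (\<lambda>i. Inl (i, m i, t)) ` T"

definition output_support :: "4 set \<Rightarrow> (4 \<Rightarrow> nat) \<Rightarrow> nat \<Rightarrow> ((4 \<times> nat \<times> nat) + nat) set" where
  "output_support T m t = insert (Inr t) (code_support T m t)"

lemma finite_code_index: "finite code_index"
proof -
  have "code_index \<subseteq> (\<Union>i\<in>UNIV. {i} \<times> (M i \<times> {..<n}))" by (auto simp: code_index_def)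
  then show ?thesis by (rule finite_subset) (auto simp: message_set)
qed

lemmas gauss = indep_vars_std_gauss_pair[OF finite_code_index finite_lessThan[of n], folded X_def]

lemma prob_space_codebook: "prob_space codebook"
  by (intro prob_space_PiM prob_space_std_gauss)

lemma sum_code_support: "(\<Sum>q\<in>code_support T m t. f q) = (\<Sum>i\<in>T. f (Inl (i, m i, t)))"
  unfolding code_support_def by (subst sum.reindex) (auto simp: inj_on_def)

lemma sum_output_support: "(\<Sum>q\<in>output_support T m t. f q) = f (Inr t) + (\<Sum>i\<in>T. f (Inl (i, m i, t)))"
proof -
  have "Inr t \<notin> code_support T m t" "finite (code_support T m t)"
    by (auto simp: code_support_def finite_subset[OF subset_UNIV])
  then show ?thesis by (simp add: output_support_def sum_code_support)
qed

lemma linear_forms: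
  "(\<Sum>q\<in>code_support T m t. weight j q * X q \<omega>) = signal j T m (fst \<omega>) t"
  "(\<Sum>q\<in>output_support T m t. weight j q * X q \<omega>) = signal j T m (fst \<omega>) t + snd \<omega> t"
  by (simp_all add: sum_code_support sum_output_support signal_def weight_def X_def)

lemma supports_subset:
  assumes "m \<in> A" "t < n"
  shows "code_support T m t \<subseteq> code_index <+> {..<n}" "output_support T m t \<subseteq> code_index <+> {..<n}"
  using assms by (auto simp: code_support_def output_support_def code_index_def message_tuplesD)

lemma rx_power_nonneg: "0 \<le> rx_power j T"
  by (simp add: rx_power_def sum_nonneg)

lemma signal_measurable:
  assumes "m \<in> A" "t < n"
  shows "(\<lambda>\<omega>. signal j T m (fst \<omega>) t) \<in> borel_measurable \<Omega>"
proof -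
  have "(i, m i, t) \<in> code_index" for i
    using assms by (auto simp: code_index_def message_tuplesD)
  then have [measurable]: "(\<lambda>\<omega>. fst \<omega> (i, m i, t)) \<in> borel_measurable \<Omega>" for i
    by (intro measurable_compose[OF measurable_fst]) simp
  show ?thesis unfolding signal_def by measurable
qed

lemma plausible_measurable:
  assumes m: "m \<in> A" and m': "m' \<in> A"
  shows "Measurable.pred \<Omega> (\<lambda>\<omega>. plausible j (fst \<omega>) m' (chan_out j m (fst \<omega>) (snd \<omega>)))"
proof -
  have [measurable]: "(\<lambda>\<omega>. \<Sum>t<n. (chan_out j m (fst \<omega>) (snd \<omega>) t - signal j T m' (fst \<omega>) t)\<^sup>2) \<in> borel_measurable \<Omega>" for T
  proof (rule borel_measurable_sum)
    fix t assume t: "t \<in> {..<n}"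
    have [measurable]: "(\<lambda>\<omega>. signal j T m (fst \<omega>) t) \<in> borel_measurable \<Omega>" "(\<lambda>\<omega>. signal j T m' (fst \<omega>) t) \<in> borel_measurable \<Omega>" for T
      using t m m' by (auto intro: signal_measurable)
    have [measurable]: "(\<lambda>\<omega>. snd \<omega> t) \<in> borel_measurable \<Omega>"
      using t by (intro measurable_compose[OF measurable_snd]) simp
    show "(\<lambda>\<omega>. (chan_out j m (fst \<omega>) (snd \<omega>) t - signal j T m' (fst \<omega>) t)\<^sup>2) \<in> borel_measurable \<Omega>"
      using t unfolding chan_out_def by simp
  qed
  show ?thesis unfolding plausible_def by measurable
qed

text \<open>Divided by its standard deviation, each residual sample is standard normal, and samples
  at different times involve disjoint sets of codebook and noise entries. So
  \<open>chi_square_concentration\<close> applies.\<close>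

lemma prob_residual_atypical:
  assumes m: "m \<in> A"
  shows "measure \<Omega> {\<omega>\<in>space \<Omega>. n * \<delta> \<le> \<bar>(\<Sum>t<n. (signal j T m (fst \<omega>) t + snd \<omega> t)\<^sup>2) / (1 + rx_power j T) - n\<bar>} \<le> 2 / (n * \<delta>\<^sup>2)"
proof -
  interpret prob_space \<Omega> by (rule gauss(1))
  let ?v = "1 + rx_power j T"
  have v: "0 < ?v" using rx_power_nonneg[of j T] by simp
  define c where "c q = weight j q / sqrt ?v" for q
  define U where "U t \<omega> = (\<Sum>q\<in>output_support T m t. c q * X q \<omega>)" for t \<omega>
  have U: "U t \<omega> = (signal j T m (fst \<omega>) t + snd \<omega> t) / sqrt ?v" for t \<omega>
  proof -
    have "U t \<omega> = (\<Sum>q\<in>output_support T m t. weight j q * X q \<omega>) / sqrt ?v"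
      by (simp add: U_def c_def sum_divide_distrib)
    then show ?thesis by (simp only: linear_forms)
  qed
  have sub: "output_support T m t \<subseteq> code_index <+> {..<n}" if "t \<in> {..<n}" for t
    using supports_subset[OF m] that by simp
  have ind: "indep_vars (\<lambda>_. borel) U {..<n}"
    unfolding U_def by (rule indep_vars_linear_forms[OF gauss(2) sub])
      (auto simp: disjoint_family_on_def output_support_def code_support_def)
  have dist: "distributed \<Omega> lborel (U t) std_normal_density" if t: "t \<in> {..<n}" for t
  proof -
    have "(\<Sum>q\<in>output_support T m t. (c q)\<^sup>2) = 1"
      using v by (simp add: sum_output_support c_def weight_def power_divide sum_divide_distrib[symmetric] rx_power_def add_divide_distrib[symmetric])
    then show ?thesis
      using normal_linear_form[of "output_support T m t" X c] indep_vars_subset[OF gauss(2) sub[OF t]] gauss(3) sub[OF t]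
      by (auto simp: U_def[abs_def] finite_subset[OF sub[OF t]] finite_code_index)
  qed
  have "(\<Sum>t<n. (U t \<omega>)\<^sup>2) = (\<Sum>t<n. (signal j T m (fst \<omega>) t + snd \<omega> t)\<^sup>2) / ?v" for \<omega>
    using v by (simp add: U power_divide sum_divide_distrib)
  moreover have "{..<n} \<noteq> {}" using n by auto
  ultimately show ?thesis
    using chi_square_concentration[OF finite_lessThan _ ind dist \<delta>] by simp
qed

text \<open>A union bound over the 16 sets \<open>T\<close>, each contributing
  \<open>2 / (n * \<delta>\<^sup>2)\<close>. For the transmitted tuple, subtracting the signals
  outside \<open>T\<close> leaves exactly the signal on \<open>T\<close> plus noise.\<close>

lemma prob_not_plausible:
  assumes m: "m \<in> A"
  shows "measure \<Omega> {\<omega>\<in>space \<Omega>. \<not> plausible j (fst \<omega>) m (chan_out j m (fst \<omega>) (snd \<omega>))} \<le> 32 / (n * \<delta>\<^sup>2)"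
proof -
  interpret prob_space \<Omega> by (rule gauss(1))
  let ?E = "\<lambda>T. {\<omega>\<in>space \<Omega>. n * \<delta> \<le> \<bar>(\<Sum>t<n. (signal j T m (fst \<omega>) t + snd \<omega> t)\<^sup>2) / (1 + rx_power j T) - n\<bar>}"
  have E_sets: "?E T \<in> events" for T
  proof -
    have [measurable]: "(\<lambda>\<omega>. \<Sum>t<n. (signal j T m (fst \<omega>) t + snd \<omega> t)\<^sup>2) \<in> borel_measurable \<Omega>"
      using signal_measurable[OF m] by (intro borel_measurable_sum borel_measurable_power borel_measurable_add)
        (auto intro!: measurable_compose[OF measurable_snd])
    show ?thesis by measurable
  qed
  have res: "chan_out j m G z t - signal j (-T) m G t = signal j T m G t + z t" if "t < n" for T G z t
  proof -
    have "signal j UNIV m G t = signal j T m G t + signal j (-T) m G t"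
      unfolding signal_def by (subst sum.union_disjoint[symmetric]) (auto intro!: sum.cong)
    then show ?thesis using that by (simp add: chan_out_def)
  qed
  have energy: "(\<Sum>t<n. (chan_out j m G z t - signal j (-T) m G t)\<^sup>2) = (\<Sum>t<n. (signal j T m G t + z t)\<^sup>2)" for T G z
    by (intro sum.cong) (auto simp: res)
  have energy_all: "(\<Sum>t<n. (chan_out j m G z t - signal j UNIV m G t)\<^sup>2) = (\<Sum>t<n. (signal j {} m G t + z t)\<^sup>2)" for G z
    using energy[of G z "{}"] by simp
  have "{\<omega>\<in>space \<Omega>. \<not> plausible j (fst \<omega>) m (chan_out j m (fst \<omega>) (snd \<omega>))} \<subseteq> (\<Union>T\<in>UNIV. ?E T)"
  proof
    fix \<omega> assume "\<omega> \<in> {\<omega>\<in>space \<Omega>. \<not> plausible j (fst \<omega>) m (chan_out j m (fst \<omega>) (snd \<omega>))}"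
    then have \<omega>: "\<omega> \<in> space \<Omega>" "\<not> plausible j (fst \<omega>) m (chan_out j m (fst \<omega>) (snd \<omega>))" by auto
    let ?S = "\<lambda>T. \<Sum>t<n. (signal j T m (fst \<omega>) t + snd \<omega> t)\<^sup>2"
    \<comment> \<open>The upper condition concerns the noise alone, hence is the case of the empty
      set, with variance one.\<close>
    consider "n * (1 + \<delta>) < ?S {}" | T where "?S T < n * (1 - \<delta>) * (1 + rx_power j T)"
      using \<omega>(2) unfolding plausible_def energy energy_all by (auto simp: not_le)
    then show "\<omega> \<in> (\<Union>T\<in>UNIV. ?E T)"
    proof cases
      case 1
      then have "\<omega> \<in> ?E {}" using \<omega> by (simp add: rx_power_def algebra_simps)
      then show ?thesis by blast
    next
      case (2 T)
      have "?S T / (1 + rx_power j T) < n * (1 - \<delta>)"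
        using 2 rx_power_nonneg[of j T] by (simp add: divide_less_eq)
      then have "\<omega> \<in> ?E T" using \<omega> by (simp add: algebra_simps)
      then show ?thesis by blast
    qed
  qed
  then have "measure \<Omega> {\<omega>\<in>space \<Omega>. \<not> plausible j (fst \<omega>) m (chan_out j m (fst \<omega>) (snd \<omega>))} \<le> measure \<Omega> (\<Union>T\<in>UNIV. ?E T)"
    by (rule finite_measure_mono) (intro sets.finite_UN E_sets finite)
  also have "\<dots> \<le> (\<Sum>T\<in>UNIV. measure \<Omega> (?E T))"
    by (rule finite_measure_subadditive_finite[OF finite]) (use E_sets in blast)
  also have "\<dots> \<le> (\<Sum>T\<in>(UNIV :: 4 set set). 2 / (n * \<delta>\<^sup>2))"
    by (intro sum_mono prob_residual_atypical m)
  also have "\<dots> = 32 / (n * \<delta>\<^sup>2)"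
    using card_Pow[of "UNIV :: 4 set"] by simp
  finally show ?thesis .
qed

text \<open>Markov's inequality for a product of independent likelihood ratios of mean one, which
  plausibility of the wrong tuple forces to be at least the inverse of the bound.\<close>

lemma prob_wrong_plausible:
  assumes m: "m \<in> A" and m': "m' \<in> A"
  defines "T \<equiv> {i. m i \<noteq> m' i}"
  shows "measure \<Omega> {\<omega>\<in>space \<Omega>. plausible j (fst \<omega>) m' (chan_out j m (fst \<omega>) (snd \<omega>))}
    \<le> exp (- (n * (ln (1 + rx_power j T) / 2 - \<delta>)))"
proof -
  interpret prob_space \<Omega> by (rule gauss(1))
  let ?v = "1 + rx_power j T"
  let ?\<gamma> = "n * (ln ?v / 2 - \<delta>)"
  let ?E = "{\<omega>\<in>space \<Omega>. plausible j (fst \<omega>) m' (chan_out j m (fst \<omega>) (snd \<omega>))}"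
  have v: "0 < ?v" using rx_power_nonneg[of j T] by simp
  \<comment> \<open>\<open>b\<close> is the output without the signals that both tuples share,
    \<open>x\<close> what the wrong tuple claims of it. The ratio \<open>r\<close> tests the claim
    that \<open>x\<close> was sent against white Gaussian output.\<close>
  define b where "b t \<omega> = (\<Sum>q\<in>output_support T m t. weight j q * X q \<omega>)" for t \<omega>
  define x where "x t \<omega> = (\<Sum>q\<in>code_support T m' t. weight j q * X q \<omega>)" for t \<omega>
  define r where "r t \<omega> = std_normal_density (b t \<omega> - x t \<omega>) / normal_density 0 (sqrt ?v) (b t \<omega>)" for t \<omega>
  have bx: "b t \<omega> = signal j T m (fst \<omega>) t + snd \<omega> t" "x t \<omega> = signal j T m' (fst \<omega>) t" for t \<omega>
    by (simp_all add: b_def x_def linear_forms)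
  have dens_pos: "0 < normal_density 0 (sqrt ?v) y" "0 < std_normal_density y" for y
    using v by (auto intro!: normal_density_pos)
  then have dens_nz: "normal_density 0 (sqrt ?v) y \<noteq> 0" "std_normal_density y \<noteq> 0" for y
    by (metis less_irrefl)+
  have r_pos: "0 < r t \<omega>" for t \<omega>
    unfolding r_def by (intro divide_pos_pos dens_pos)
  have sub: "output_support T m t \<subseteq> code_index <+> {..<n}" "code_support T m' t \<subseteq> code_index <+> {..<n}" if "t \<in> {..<n}" for t
    using supports_subset[OF m] supports_subset[OF m'] that by auto
  \<comment> \<open>The tuples differ everywhere on \<open>T\<close>, so the wrong codewords are
    independent of the output \<open>b\<close>.\<close>
  have disj: "output_support T m t \<inter> code_support T m' t = {}" for t
    by (auto simp: output_support_def code_support_def T_def)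
  have fin: "finite (output_support T m t)" "finite (code_support T m' t)" for t
    by (auto simp: output_support_def code_support_def)
  have r1: "(\<integral>\<^sup>+\<omega>. ennreal (r t \<omega>) \<partial>\<Omega>) = 1" if t: "t \<in> {..<n}" for t
  proof -
    have "indep_var borel ((\<lambda>y. \<Sum>q\<in>code_support T m' t. weight j q * y q) \<circ> (\<lambda>\<omega>. restrict (\<lambda>q. X q \<omega>) (code_support T m' t)))
       borel ((\<lambda>y. \<Sum>q\<in>output_support T m t. weight j q * y q) \<circ> (\<lambda>\<omega>. restrict (\<lambda>q. X q \<omega>) (output_support T m t)))"
      using disj sub[OF t] by (intro indep_var_compose[OF indep_var_restrict[OF gauss(2)]]) auto
    then have ind: "indep_var borel (x t) borel (b t)"
      by (simp add: comp_def x_def[abs_def] b_def[abs_def])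
    have s: "(\<Sum>q\<in>output_support T m t. (weight j q)\<^sup>2) = ?v"
      by (simp add: sum_output_support weight_def rx_power_def)
    have "distributed \<Omega> lborel (b t) (normal_density 0 (sqrt ?v))"
      using normal_linear_form[of "output_support T m t" X "weight j"] indep_vars_subset[OF gauss(2) sub(1)[OF t]] gauss(3) sub(1)[OF t] v fin
      unfolding s b_def[abs_def] by auto
    then show ?thesis
      unfolding r_def using v by (intro nn_integral_gauss_ratio[OF ind]) auto
  qed
  have ind_r: "indep_vars (\<lambda>_. borel) (\<lambda>t \<omega>. ennreal (r t \<omega>)) {..<n}"
  proof -
    define J where "J t = output_support T m t \<union> code_support T m' t" for t
    define F where "F t y = (let b = \<Sum>q\<in>output_support T m t. weight j q * y q; x = \<Sum>q\<in>code_support T m' t. weight j q * y q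
        in std_normal_density (b - x) / normal_density 0 (sqrt ?v) b)" for t and y :: "(4 \<times> nat \<times> nat) + nat \<Rightarrow> real"
    have "indep_vars (\<lambda>_. borel) (\<lambda>t \<omega>. F t (\<lambda>q\<in>J t. X q \<omega>)) {..<n}"
    proof (rule indep_vars_group[OF gauss(2)])
      show "J t \<subseteq> code_index <+> {..<n}" if "t \<in> {..<n}" for t
        using sub[OF that] by (simp add: J_def)
      show "disjoint_family_on J {..<n}"
        by (auto simp: disjoint_family_on_def J_def output_support_def code_support_def)
      show "F t \<in> borel_measurable (\<Pi>\<^sub>M q\<in>J t. borel)" for t
      proof -
        have [measurable]: "(\<lambda>y. \<Sum>q\<in>output_support T m t. weight j q * y q) \<in> borel_measurable (\<Pi>\<^sub>M q\<in>J t. borel)"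
          "(\<lambda>y. \<Sum>q\<in>code_support T m' t. weight j q * y q) \<in> borel_measurable (\<Pi>\<^sub>M q\<in>J t. borel)"
          by (auto intro!: borel_measurable_sum borel_measurable_times simp: J_def)
        show ?thesis unfolding F_def Let_def by measurable
      qed
    qed
    moreover have "F t (\<lambda>q\<in>J t. X q \<omega>) = r t \<omega>" for t \<omega>
      by (simp add: F_def J_def r_def b_def x_def Let_def)
    ultimately have "indep_vars (\<lambda>_. borel) r {..<n}" by simp
    then show ?thesis by (rule indep_vars_compose2) simp
  qed
  have total: "(\<integral>\<^sup>+\<omega>. (\<Prod>t<n. ennreal (r t \<omega>)) \<partial>\<Omega>) = 1"
    by (subst indep_vars_nn_integral[OF _ ind_r]) (auto simp: r1)
  \<comment> \<open>On \<open>?E\<close> the two energies in the logarithm of the product are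
    controlled by the two halves of \<open>plausible\<close>. Each costs
    \<open>n * \<delta> / 2\<close>, which gives the loss \<open>\<delta>\<close> in the
    exponent.\<close>
  have bound: "indicator ?E \<omega> \<le> ennreal (exp (- ?\<gamma>)) * (\<Prod>t<n. ennreal (r t \<omega>))" for \<omega>
  proof (cases "\<omega> \<in> ?E")
    case True
    then have pl: "plausible j (fst \<omega>) m' (chan_out j m (fst \<omega>) (snd \<omega>))" by simp
    have agree: "signal j (-T) m' (fst \<omega>) t = signal j (-T) m (fst \<omega>) t" for t
      by (auto simp: signal_def T_def intro!: sum.cong)
    have split: "signal j UNIV l (fst \<omega>) t = signal j T l (fst \<omega>) t + signal j (-T) l (fst \<omega>) t" for l t
      unfolding signal_def by (subst sum.union_disjoint[symmetric]) (auto intro!: sum.cong)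
    have "(\<Sum>t<n. (b t \<omega> - x t \<omega>)\<^sup>2) = (\<Sum>t<n. (chan_out j m (fst \<omega>) (snd \<omega>) t - signal j UNIV m' (fst \<omega>) t)\<^sup>2)"
      by (intro sum.cong refl arg_cong[where f="\<lambda>x. x\<^sup>2"]) (simp add: bx chan_out_def split agree)
    also have "\<dots> \<le> n * (1 + \<delta>)" using pl by (simp add: plausible_def)
    finally have 1: "(\<Sum>t<n. (b t \<omega> - x t \<omega>)\<^sup>2) \<le> n * (1 + \<delta>)" .
    have "n * (1 - \<delta>) * ?v \<le> (\<Sum>t<n. (chan_out j m (fst \<omega>) (snd \<omega>) t - signal j (-T) m' (fst \<omega>) t)\<^sup>2)"
      using pl by (simp add: plausible_def)
    also have "\<dots> = (\<Sum>t<n. (b t \<omega>)\<^sup>2)"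
      by (intro sum.cong refl arg_cong[where f="\<lambda>x. x\<^sup>2"]) (simp add: bx chan_out_def split agree)
    finally have 2: "n * (1 - \<delta>) \<le> (\<Sum>t<n. (b t \<omega>)\<^sup>2) / ?v"
      using v by (simp add: le_divide_eq)
    have arith: "S \<le> N * (1 + d) \<Longrightarrow> N * (1 - d) \<le> B \<Longrightarrow> N * (u - d) \<le> N * u + B / 2 - S / 2" for S N B u d :: real
      by (simp add: algebra_simps)
    have ln_r: "ln (r t \<omega>) = ln ?v / 2 + (b t \<omega>)\<^sup>2 / (2 * ?v) - (b t \<omega> - x t \<omega>)\<^sup>2 / 2" for t
      using ln_normal_density_ratio[OF v, of "b t \<omega>" "b t \<omega> - x t \<omega>"] dens_nz unfolding r_def
      by (simp add: ln_div)
    have "ln (\<Prod>t<n. r t \<omega>) = (\<Sum>t<n. ln (r t \<omega>))"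
      using r_pos by (intro ln_prod) (auto simp: less_imp_neq[symmetric])
    also have "\<dots> = n * (ln ?v / 2) + (\<Sum>t<n. (b t \<omega>)\<^sup>2) / (2 * ?v) - (\<Sum>t<n. (b t \<omega> - x t \<omega>)\<^sup>2) / 2"
      unfolding ln_r by (simp only: sum.distrib sum_subtractf sum_divide_distrib sum_constant card_lessThan)
    also have "(\<Sum>t<n. (b t \<omega>)\<^sup>2) / (2 * ?v) = (\<Sum>t<n. (b t \<omega>)\<^sup>2) / ?v / 2"
      by (simp only: divide_divide_eq_left mult.commute)
    also have "n * (ln ?v / 2) + (\<Sum>t<n. (b t \<omega>)\<^sup>2) / ?v / 2 - (\<Sum>t<n. (b t \<omega> - x t \<omega>)\<^sup>2) / 2 \<ge> ?\<gamma>"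
      by (rule arith[OF 1 2])
    finally have "exp ?\<gamma> \<le> (\<Prod>t<n. r t \<omega>)"
      by (subst (asm) ln_ge_iff) (simp_all add: prod_pos r_pos)
    then have "1 \<le> exp (- ?\<gamma>) * (\<Prod>t<n. r t \<omega>)"
      by (simp add: exp_minus field_simps)
    then have "ennreal 1 \<le> ennreal (exp (- ?\<gamma>) * (\<Prod>t<n. r t \<omega>))"
      by (rule ennreal_leI)
    also have "\<dots> = ennreal (exp (- ?\<gamma>)) * (\<Prod>t<n. ennreal (r t \<omega>))"
      using r_pos[THEN less_imp_le] by (simp add: ennreal_mult prod_nonneg prod_ennreal)
    finally show ?thesis using True by simp
  qed simp
  have [measurable]: "(\<lambda>\<omega>. ennreal (r t \<omega>)) \<in> borel_measurable \<Omega>" if "t \<in> {..<n}" for t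
    using ind_r that by (auto simp: indep_vars_def)
  have "?E \<in> events" using plausible_measurable[OF m m'] by simp
  then have "emeasure \<Omega> ?E = (\<integral>\<^sup>+\<omega>. indicator ?E \<omega> \<partial>\<Omega>)" by simp
  also have "\<dots> \<le> (\<integral>\<^sup>+\<omega>. ennreal (exp (- ?\<gamma>)) * (\<Prod>t<n. ennreal (r t \<omega>)) \<partial>\<Omega>)"
    by (intro nn_integral_mono bound)
  also have "\<dots> = ennreal (exp (- ?\<gamma>)) * (\<integral>\<^sup>+\<omega>. (\<Prod>t<n. ennreal (r t \<omega>)) \<partial>\<Omega>)"
    by (intro nn_integral_cmult borel_measurable_prod) auto
  finally show ?thesis
    by (simp add: total emeasure_eq_measure)
qed

end

section \<open>Selecting one codebook from the ensemble\<close>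

text \<open>The same sum is integrated twice, over codebook and noise jointly and over the noise
  with the codebook frozen; this rule serves both.\<close>

lemma has_bochner_integral_union_bound:
  fixes u :: "'m \<Rightarrow> 'j \<Rightarrow> 'a \<Rightarrow> real" and c :: real
  assumes "\<And>m j. m \<in> A \<Longrightarrow> has_bochner_integral N (u m j) (U m j)"
    and "\<And>m m' j. m \<in> A \<Longrightarrow> m' \<in> A - {m} \<Longrightarrow> has_bochner_integral N (v m j m') (V m j m')"
    and "\<And>i. has_bochner_integral N (w i) (W i)"
  shows "has_bochner_integral N (\<lambda>\<omega>. (\<Sum>m\<in>A. \<Sum>j\<in>J. u m j \<omega> + (\<Sum>m'\<in>A - {m}. v m j m' \<omega>)) / c + (\<Sum>i\<in>I. w i \<omega>))
    ((\<Sum>m\<in>A. \<Sum>j\<in>J. U m j + (\<Sum>m'\<in>A - {m}. V m j m')) / c + (\<Sum>i\<in>I. W i))"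
  by (intro has_bochner_integral_add has_bochner_integral_divide_zero has_bochner_integral_sum assms) auto

context random_codebook begin

text \<open>The power constraint averages over the messages, so a single event about the total
  energy of the codebook of a transmitter controls it, rather than one event for each
  codeword.\<close>

definition atypical_power :: "real \<Rightarrow> 4 \<Rightarrow> (4 \<times> nat \<times> nat \<Rightarrow> real) \<Rightarrow> bool" where
  "atypical_power \<eta> i G \<longleftrightarrow> real (card (M i) * n) * \<eta> \<le> \<bar>(\<Sum>(k, t)\<in>M i \<times> {..<n}. (G (i, k, t))\<^sup>2) - real (card (M i) * n)\<bar>"

lemma atypical_power_measurable: "Measurable.pred \<Omega> (\<lambda>\<omega>. atypical_power \<eta> i (fst \<omega>))"
proof -
  have [measurable]: "(\<lambda>\<omega>. \<Sum>(k, t)\<in>M i \<times> {..<n}. (fst \<omega> (i, k, t))\<^sup>2) \<in> borel_measurable \<Omega>"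
    unfolding case_prod_unfold
    by (intro borel_measurable_sum borel_measurable_power measurable_compose[OF measurable_fst])
      (auto simp: code_index_def)
  show ?thesis unfolding atypical_power_def by measurable
qed

lemma prob_atypical_power:
  fixes \<eta> :: real
  assumes "0 < \<eta>"
  shows "measure \<Omega> {\<omega>\<in>space \<Omega>. atypical_power \<eta> i (fst \<omega>)} \<le> 2 / (n * \<eta>\<^sup>2)"
proof -
  interpret prob_space \<Omega> by (rule gauss(1))
  define K where "K = (\<lambda>(k, t). Inl (i, k, t) :: (4 \<times> nat \<times> nat) + nat) ` (M i \<times> {..<n})"
  have inj: "inj_on (\<lambda>(k, t). Inl (i, k, t) :: (4 \<times> nat \<times> nat) + nat) (M i \<times> {..<n})"
    by (auto simp: inj_on_def)
  have K: "finite K" "card K = card (M i) * n" "K \<subseteq> code_index <+> {..<n}"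
    unfolding K_def using card_image[OF inj] by (auto simp: message_set code_index_def card_cartesian_product)
  have cM: "1 \<le> card (M i)" using message_set(2)[of n "R $ i"] by simp
  then have ne: "K \<noteq> {}" using K n by (metis card.empty mult_is_0 not_one_le_zero not_less0)
  have sum: "(\<Sum>q\<in>K. (X q \<omega>)\<^sup>2) = (\<Sum>(k, t)\<in>M i \<times> {..<n}. (fst \<omega> (i, k, t))\<^sup>2)" for \<omega>
    unfolding K_def by (subst sum.reindex[OF inj]) (auto simp: X_def case_prod_unfold)
  have dist: "distributed \<Omega> lborel (X q) std_normal_density" if "q \<in> K" for q
    using gauss(3) K(3) that by auto
  have "measure \<Omega> {\<omega>\<in>space \<Omega>. card K * \<eta> \<le> \<bar>(\<Sum>q\<in>K. (X q \<omega>)\<^sup>2) - card K\<bar>} \<le> 2 / (card K * \<eta>\<^sup>2)"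
    using chi_square_concentration[OF K(1) ne indep_vars_subset[OF gauss(2) K(3)]] dist assms by blast
  \<comment> \<open>The larger number of samples is given up, so that the bound does not depend on
    the number of messages.\<close>
  also have "\<dots> \<le> 2 / (n * \<eta>\<^sup>2)"
  proof (rule divide_left_mono)
    have "1 * real n \<le> card (M i) * real n" using cM by (intro mult_right_mono) auto
    then show "n * \<eta>\<^sup>2 \<le> card K * \<eta>\<^sup>2" unfolding K(2) by (intro mult_right_mono) auto
    show "0 < card K * \<eta>\<^sup>2 * (n * \<eta>\<^sup>2)" using n cM assms by (simp add: K(2))
  qed simp
  finally show ?thesis unfolding sum K(2) atypical_power_def .
qed

lemma section_integral:
  assumes E: "{\<omega>\<in>space \<Omega>. Q \<omega>} \<in> sets \<Omega>" and G: "G \<in> space codebook"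
  shows "has_bochner_integral (white_noise n) (\<lambda>z. indicat_real {\<omega>\<in>space \<Omega>. Q \<omega>} (G, z)) (measure (white_noise n) {z\<in>space (white_noise n). Q (G, z)})"
    and "{z\<in>space (white_noise n). Q (G, z)} \<in> sets (white_noise n)"
proof -
  interpret W: prob_space "white_noise n" by (rule prob_space_white_noise)
  have "Pair G -` {\<omega>\<in>space \<Omega>. Q \<omega>} = {z\<in>space (white_noise n). Q (G, z)}"
    using G by (auto simp: space_pair_measure)
  then show meas: "{z\<in>space (white_noise n). Q (G, z)} \<in> sets (white_noise n)"
    using sets_Pair1[OF E, of G] by simp
  have eq: "indicat_real {\<omega>\<in>space \<Omega>. Q \<omega>} (G, z) = indicator {z\<in>space (white_noise n). Q (G, z)} z" for z
    using G by (auto simp: indicator_def space_pair_measure)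
  show "has_bochner_integral (white_noise n) (\<lambda>z. indicat_real {\<omega>\<in>space \<Omega>. Q \<omega>} (G, z)) (measure (white_noise n) {z\<in>space (white_noise n). Q (G, z)})"
    unfolding eq using meas by (intro has_bochner_integral_real_indicator) (auto simp: W.emeasure_eq_measure)
qed

text \<open>The hypothesis on \<open>e\<close> collects the union bound: misses at both receivers,
  wrong tuples grouped by the set \<open>T\<close> on which they are wrong, and four power
  events.\<close>

lemma exists_good_code:
  fixes \<eta> e :: real
  assumes \<eta>: "0 < \<eta>" and P: "\<And>i. P i = (a i)\<^sup>2 * (1 + \<eta>)"
    and e: "(\<Sum>j\<in>UNIV. 32 / (n * \<delta>\<^sup>2) + (\<Sum>T\<in>UNIV - {{}}. (\<Prod>i\<in>T. real (card (M i)) - 1) *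
        exp (- (n * (ln (1 + (\<Sum>i\<in>T. (h i j * a i)\<^sup>2)) / 2 - \<delta>))))) + 8 / (n * \<eta>\<^sup>2) < e"
    and "e \<le> 1"
  shows "\<exists>f g. is_code P n R f g \<and> error_prob h n R f g \<le> e"
proof -
  interpret prob_space \<Omega> by (rule gauss(1))
  interpret W: prob_space "white_noise n" by (rule prob_space_white_noise)
  interpret Z: prob_space "noise_space n" by (rule prob_space_noise_space)
  have cA: "0 < real (card A)" using message_tuples(2) by simp
  define miss where "miss j m \<omega> \<longleftrightarrow> \<not> plausible j (fst \<omega>) m (chan_out j m (fst \<omega>) (snd \<omega>))" for j m \<omega>
  define conf where "conf j m m' \<omega> \<longleftrightarrow> plausible j (fst \<omega>) m' (chan_out j m (fst \<omega>) (snd \<omega>))" for j m m' \<omega>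
  define viol where "viol i \<omega> \<longleftrightarrow> atypical_power \<eta> i (fst \<omega>)" for i and \<omega> :: "(4 \<times> nat \<times> nat \<Rightarrow> real) \<times> (nat \<Rightarrow> real)"
  let ?I = "\<lambda>Q \<omega>. indicat_real {\<omega>\<in>space \<Omega>. Q \<omega>} \<omega>"
  have meas: "{\<omega>\<in>space \<Omega>. miss j m \<omega>} \<in> events" "{\<omega>\<in>space \<Omega>. conf j m m' \<omega>} \<in> events" "{\<omega>\<in>space \<Omega>. viol i \<omega>} \<in> events"
    if "m \<in> A" "m' \<in> A" for j m m' i
    using plausible_measurable[OF that] plausible_measurable[OF that(1) that(1)] atypical_power_measurable
    by (simp_all add: miss_def conf_def viol_def)
  have meas': "{\<omega>\<in>space \<Omega>. viol i \<omega>} \<in> events" for i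
    using atypical_power_measurable by (simp add: viol_def)
  have ind: "has_bochner_integral \<Omega> (?I Q) (measure \<Omega> {\<omega>\<in>space \<Omega>. Q \<omega>})" if "{\<omega>\<in>space \<Omega>. Q \<omega>} \<in> events" for Q
    using that by (intro has_bochner_integral_real_indicator) (auto simp: emeasure_eq_measure)
  \<comment> \<open>Error events are averaged over the message tuples, but power violations enter
    with full weight one. A single bound on the mean of \<open>\<phi>\<close> thus controls both
    requirements for the same codebook.\<close>
  define \<phi> where "\<phi> \<omega> = (\<Sum>m\<in>A. \<Sum>j\<in>UNIV. ?I (miss j m) \<omega> + (\<Sum>m'\<in>A - {m}. ?I (conf j m m') \<omega>)) / card A + (\<Sum>i\<in>UNIV. ?I (viol i) \<omega>)" for \<omega>
  let ?w = "\<lambda>j T. exp (- (n * (ln (1 + rx_power j T) / 2 - \<delta>)))"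
  let ?c = "\<lambda>T. \<Prod>i\<in>T. real (card (M i)) - 1"
  have "has_bochner_integral \<Omega> \<phi> ((\<Sum>m\<in>A. \<Sum>j\<in>UNIV. measure \<Omega> {\<omega>\<in>space \<Omega>. miss j m \<omega>} + (\<Sum>m'\<in>A - {m}. measure \<Omega> {\<omega>\<in>space \<Omega>. conf j m m' \<omega>})) / card A
      + (\<Sum>i\<in>UNIV. measure \<Omega> {\<omega>\<in>space \<Omega>. viol i \<omega>}))"
    unfolding \<phi>_def by (intro has_bochner_integral_union_bound ind meas meas') auto
  then have int_\<phi>: "integrable \<Omega> \<phi>" and "expectation \<phi> = (\<Sum>m\<in>A. \<Sum>j\<in>UNIV. measure \<Omega> {\<omega>\<in>space \<Omega>. miss j m \<omega>} + (\<Sum>m'\<in>A - {m}. measure \<Omega> {\<omega>\<in>space \<Omega>. conf j m m' \<omega>})) / card A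
      + (\<Sum>i\<in>UNIV. measure \<Omega> {\<omega>\<in>space \<Omega>. viol i \<omega>})"
    by (auto simp: has_bochner_integral_iff)
  note this(2)
  also have "\<dots> \<le> (\<Sum>m\<in>A. \<Sum>j\<in>UNIV. 32 / (n * \<delta>\<^sup>2) + (\<Sum>T\<in>UNIV - {{}}. ?c T * ?w j T)) / card A + (\<Sum>i\<in>(UNIV :: 4 set). 2 / (n * \<eta>\<^sup>2))"
  proof (intro add_mono divide_right_mono sum_mono)
    fix m j assume m: "m \<in> A"
    show "measure \<Omega> {\<omega>\<in>space \<Omega>. miss j m \<omega>} \<le> 32 / (n * \<delta>\<^sup>2)"
      unfolding miss_def by (rule prob_not_plausible[OF m])
    have "(\<Sum>m'\<in>A - {m}. measure \<Omega> {\<omega>\<in>space \<Omega>. conf j m m' \<omega>}) \<le> (\<Sum>m'\<in>A - {m}. ?w j {i. m i \<noteq> m' i})"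
      unfolding conf_def by (intro sum_mono prob_wrong_plausible m) auto
    also have "\<dots> = (\<Sum>T\<in>UNIV - {{}}. \<Sum>m'\<in>{m'\<in>A - {m}. {i. m i \<noteq> m' i} = T}. ?w j {i. m i \<noteq> m' i})"
      using message_tuples(1) by (intro sum.group[symmetric]) (auto simp: fun_eq_iff)
    also have "\<dots> = (\<Sum>T\<in>UNIV - {{}}. card {m'\<in>A - {m}. {i. m i \<noteq> m' i} = T} * ?w j T)"
      by (intro sum.cong) auto
    also have "\<dots> \<le> (\<Sum>T\<in>UNIV - {{}}. ?c T * ?w j T)"
    proof (intro sum_mono mult_right_mono)
      fix T
      have "card {m'\<in>A - {m}. {i. m i \<noteq> m' i} = T} \<le> card {m'\<in>A. {i. m i \<noteq> m' i} = T}"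
        using message_tuples(1) by (intro card_mono) auto
      then have "real (card {m'\<in>A - {m}. {i. m i \<noteq> m' i} = T}) \<le> real (card {m'\<in>A. {i. m i \<noteq> m' i} = T})"
        by (rule of_nat_mono)
      also have "\<dots> \<le> ?c T" by (rule card_differ_exactly[OF m])
      finally show "real (card {m'\<in>A - {m}. {i. m i \<noteq> m' i} = T}) \<le> ?c T" .
    qed simp
    finally show "(\<Sum>m'\<in>A - {m}. measure \<Omega> {\<omega>\<in>space \<Omega>. conf j m m' \<omega>}) \<le> (\<Sum>T\<in>UNIV - {{}}. ?c T * ?w j T)" .
  next
    fix i
    show "measure \<Omega> {\<omega>\<in>space \<Omega>. viol i \<omega>} \<le> 2 / (n * \<eta>\<^sup>2)"
      unfolding viol_def by (rule prob_atypical_power[OF \<eta>])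
  qed simp
  also have "\<dots> = (\<Sum>j\<in>UNIV. 32 / (n * \<delta>\<^sup>2) + (\<Sum>T\<in>UNIV - {{}}. ?c T * ?w j T)) + 8 / (n * \<eta>\<^sup>2)"
    using cA by simp
  also have "\<dots> < e" using e by (simp add: rx_power_def)
  finally have "expectation \<phi> < e" .
  then obtain G where G: "G \<in> space codebook" and int_G: "(\<integral>z. \<phi> (G, z) \<partial>white_noise n) < e"
    using exists_section_le[OF prob_space_codebook prob_space_white_noise int_\<phi>] by blast
  let ?\<mu> = "\<lambda>Q. measure (white_noise n) {z\<in>space (white_noise n). Q (G, z)}"
  have "has_bochner_integral (white_noise n) (\<lambda>z. \<phi> (G, z)) ((\<Sum>m\<in>A. \<Sum>j\<in>UNIV. ?\<mu> (miss j m) + (\<Sum>m'\<in>A - {m}. ?\<mu> (conf j m m'))) / card A + (\<Sum>i\<in>UNIV. ?\<mu> (viol i)))"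
    unfolding \<phi>_def by (intro has_bochner_integral_union_bound section_integral(1) meas meas' G) auto
  then have "(\<integral>z. \<phi> (G, z) \<partial>white_noise n) = (\<Sum>m\<in>A. \<Sum>j\<in>UNIV. ?\<mu> (miss j m) + (\<Sum>m'\<in>A - {m}. ?\<mu> (conf j m m'))) / card A + (\<Sum>i\<in>UNIV. ?\<mu> (viol i))"
    by (rule has_bochner_integral_integral_eq)
  with int_G have small: "(\<Sum>m\<in>A. \<Sum>j\<in>UNIV. ?\<mu> (miss j m) + (\<Sum>m'\<in>A - {m}. ?\<mu> (conf j m m'))) / card A + (\<Sum>i\<in>UNIV. ?\<mu> (viol i)) < e"
    by simp
  \<comment> \<open>A violation does not depend on the noise and would contribute a full 1 to the
    integral, against \<open>e \<le> 1\<close>. So the codebook meets the power constraint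
    outright.\<close>
  have typical: "\<not> atypical_power \<eta> i G" for i
  proof
    assume "atypical_power \<eta> i G"
    then have "?\<mu> (viol i) = 1" using W.prob_space by (simp add: viol_def)
    moreover have "?\<mu> (viol i) \<le> (\<Sum>i\<in>UNIV. ?\<mu> (viol i))" by (intro member_le_sum) auto
    moreover have "0 \<le> (\<Sum>m\<in>A. \<Sum>j\<in>UNIV. ?\<mu> (miss j m) + (\<Sum>m'\<in>A - {m}. ?\<mu> (conf j m m'))) / card A"
      by (intro divide_nonneg_nonneg sum_nonneg add_nonneg_nonneg) auto
    ultimately show False using small \<open>e \<le> 1\<close> by linarith
  qed
  define f where "f i k = (\<lambda>t\<in>{..<n}. a i * G (i, k, t))" for i k
  have rec: "received h n f j m z = chan_out j m G z" for j m z
    by (auto simp: received_def chan_out_def signal_def f_def fun_eq_iff mult_ac)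
  have "Measurable.pred (block_space n) (plausible j G m)" for j m
    unfolding plausible_def by measurable
  from decoder_exists[where plaus="\<lambda>j. plausible j G" and R=R, OF this] obtain g
    where g: "\<And>i. g i \<in> block_space n \<rightarrow>\<^sub>M count_space (M i)"
      and dec: "\<And>i m y. m \<in> A \<Longrightarrow> \<forall>m'\<in>A. plausible (intended_receiver i) G m' y \<longleftrightarrow> m' = m \<Longrightarrow> g i y = m i"
    by blast
  have code: "is_code P n R f g"
    unfolding is_code_def
  proof (intro conjI allI g)
    fix i
    show "f i \<in> M i \<rightarrow> space (block_space n)" by (auto simp: f_def space_PiM)
    let ?S = "\<Sum>(k, t)\<in>M i \<times> {..<n}. (G (i, k, t))\<^sup>2"
    have cM: "0 < real (card (M i))" using message_set(2) by simp
    have avg: "(\<integral>\<omega>. (f i (fst \<omega> i) t)\<^sup>2 \<partial>sample_space n R) = (\<Sum>k\<in>M i. (f i k t)\<^sup>2) / card (M i)" for t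
      by (rule integral_sample_space_message)
    have "1 / n * (\<Sum>t<n. \<integral>\<omega>. (f i (fst \<omega> i) t)\<^sup>2 \<partial>sample_space n R) = 1 / n * ((\<Sum>t<n. \<Sum>k\<in>M i. (f i k t)\<^sup>2) / card (M i))"
      by (simp only: avg sum_divide_distrib)
    also have "(\<Sum>t<n. \<Sum>k\<in>M i. (f i k t)\<^sup>2) = (a i)\<^sup>2 * ?S"
      by (subst sum.swap) (simp add: f_def power_mult_distrib sum_distrib_left sum.cartesian_product)
    also have "1 / n * ((a i)\<^sup>2 * ?S / card (M i)) = (a i)\<^sup>2 * (?S / (card (M i) * n))"
      by simp
    also have "\<dots> \<le> (a i)\<^sup>2 * (1 + \<eta>)"
    proof (rule mult_left_mono)
      have "?S \<le> card (M i) * n * (1 + \<eta>)"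
        using typical[of i] by (simp add: atypical_power_def not_le abs_less_iff algebra_simps)
      then show "?S / (card (M i) * n) \<le> 1 + \<eta>"
        using cM n by (simp add: divide_le_eq algebra_simps)
    qed simp
    finally show "1 / n * (\<Sum>t<n. \<integral>\<omega>. (f i (fst \<omega> i) t)\<^sup>2 \<partial>sample_space n R) \<le> P i"
      by (simp add: P)
  qed
  have err_m: "measure (noise_space n) {z \<in> space (noise_space n).
      \<exists>i. g i (received h n f (intended_receiver i) m (z (intended_receiver i))) \<noteq> m i}
    \<le> (\<Sum>j\<in>UNIV. ?\<mu> (miss j m) + (\<Sum>m'\<in>A - {m}. ?\<mu> (conf j m m')))" (is "measure _ ?err \<le> _") if m: "m \<in> A" for m
  proof -
    define bad where "bad j z \<longleftrightarrow> miss j m (G, z) \<or> (\<exists>m'\<in>A - {m}. conf j m m' (G, z))" for j z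
    have miss_sets: "{z\<in>space (white_noise n). miss j m (G, z)} \<in> sets (white_noise n)" for j
      by (rule section_integral(2)[OF meas(1)[OF m m] G])
    have conf_sets: "{z\<in>space (white_noise n). conf j m m' (G, z)} \<in> sets (white_noise n)" if "m' \<in> A" for j m'
      by (rule section_integral(2)[OF meas(2)[OF m that] G])
    have bad_eq: "{z\<in>space (white_noise n). bad j z} = {z\<in>space (white_noise n). miss j m (G, z)} \<union>
        (\<Union>m'\<in>A - {m}. {z\<in>space (white_noise n). conf j m m' (G, z)})" for j
      by (auto simp: bad_def)
    have conf_un: "(\<Union>m'\<in>A - {m}. {z\<in>space (white_noise n). conf j m m' (G, z)}) \<in> sets (white_noise n)" for j
      using message_tuples(1) conf_sets by (intro sets.finite_UN) auto
    have bad_sets: "{z\<in>space (white_noise n). bad j z} \<in> sets (white_noise n)" for j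
      unfolding bad_eq by (intro sets.Un miss_sets conf_un)
    then have bad_pred: "Measurable.pred (white_noise n) (bad j)" for j by (simp add: pred_def)
    have bad_noise: "{z\<in>space (noise_space n). bad j (z j)} \<in> sets (noise_space n)" for j
      using measurable_compose[OF noise_space_component bad_pred] by simp
    have "?err \<subseteq> (\<Union>j\<in>UNIV. {z\<in>space (noise_space n). bad j (z j)})"
    proof
      fix z assume z: "z \<in> ?err"
      then obtain i where i: "g i (chan_out (intended_receiver i) m G (z (intended_receiver i))) \<noteq> m i"
        by (auto simp: rec)
      have "bad (intended_receiver i) (z (intended_receiver i))"
      proof (rule ccontr)
        let ?y = "chan_out (intended_receiver i) m G (z (intended_receiver i))"
        assume "\<not> bad (intended_receiver i) (z (intended_receiver i))"
        then have "plausible (intended_receiver i) G m ?y" "\<And>m'. m' \<in> A - {m} \<Longrightarrow> \<not> plausible (intended_receiver i) G m' ?y"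
          by (auto simp: bad_def miss_def conf_def)
        then have "\<forall>m'\<in>A. plausible (intended_receiver i) G m' ?y \<longleftrightarrow> m' = m" by blast
        with i show False using dec[OF m] by blast
      qed
      then show "z \<in> (\<Union>j\<in>UNIV. {z\<in>space (noise_space n). bad j (z j)})" using z by auto
    qed
    then have "measure (noise_space n) ?err \<le> measure (noise_space n) (\<Union>j\<in>UNIV. {z\<in>space (noise_space n). bad j (z j)})"
      by (rule Z.finite_measure_mono) (rule sets.finite_UN[OF finite bad_noise])
    also have "\<dots> \<le> (\<Sum>j\<in>UNIV. measure (noise_space n) {z\<in>space (noise_space n). bad j (z j)})"
      by (rule Z.finite_measure_subadditive_finite[OF finite]) (rule image_subsetI, rule bad_noise)
    also have "\<dots> = (\<Sum>j\<in>UNIV. measure (white_noise n) {z\<in>space (white_noise n). bad j z})"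
      by (intro sum.cong refl measure_noise_component bad_pred)
    also have "\<dots> \<le> (\<Sum>j\<in>UNIV. ?\<mu> (miss j m) + (\<Sum>m'\<in>A - {m}. ?\<mu> (conf j m m')))"
    proof (rule sum_mono)
      fix j
      have "measure (white_noise n) {z\<in>space (white_noise n). bad j z} \<le> ?\<mu> (miss j m) +
          measure (white_noise n) (\<Union>m'\<in>A - {m}. {z\<in>space (white_noise n). conf j m m' (G, z)})"
        unfolding bad_eq by (intro measure_subadditive miss_sets conf_un) auto
      also have "measure (white_noise n) (\<Union>m'\<in>A - {m}. {z\<in>space (white_noise n). conf j m m' (G, z)}) \<le> (\<Sum>m'\<in>A - {m}. ?\<mu> (conf j m m'))"
        by (rule W.finite_measure_subadditive_finite) (use message_tuples(1) conf_sets in auto)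
      finally show "measure (white_noise n) {z\<in>space (white_noise n). bad j z} \<le> ?\<mu> (miss j m) + (\<Sum>m'\<in>A - {m}. ?\<mu> (conf j m m'))"
        by simp
    qed
    finally show ?thesis .
  qed
  have "error_prob h n R f g \<le> (\<Sum>m\<in>A. \<Sum>j\<in>UNIV. ?\<mu> (miss j m) + (\<Sum>m'\<in>A - {m}. ?\<mu> (conf j m m'))) / card A"
    unfolding error_prob_eq[OF g] by (intro divide_right_mono sum_mono err_m) auto
  moreover have "0 \<le> (\<Sum>i\<in>UNIV. ?\<mu> (viol i))" by (intro sum_nonneg) auto
  ultimately have "error_prob h n R f g \<le> e" using small by linarith
  with code show ?thesis by blast
qed

end

section \<open>Random coding as the block length grows\<close>

text \<open>\<open>achievable\<close> demands a code at every length from 1 on; this one fills the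
  lengths where the random coding bound exceeds one.\<close>

lemma trivial_code:
  assumes P: "\<And>i. 0 \<le> P i"
  shows "\<exists>f g. is_code P n R f g \<and> error_prob h n R f g \<le> 1"
proof (intro exI conjI)
  show "is_code P n R (\<lambda>i k. \<lambda>t\<in>{..<n}. 0) (\<lambda>i y. 1)"
    unfolding is_code_def
  proof (intro conjI allI)
    fix i
    show "(\<lambda>y. 1) \<in> block_space n \<rightarrow>\<^sub>M count_space (message_set n (R $ i))"
      by (rule measurable_const) (use message_set(4) in simp)
    have "(\<Sum>t<n. \<integral>\<omega>. ((\<lambda>t\<in>{..<n}. 0 :: real) t)\<^sup>2 \<partial>sample_space n R) = 0"
      by (rule sum.neutral) auto
    then show "1 / real n * (\<Sum>t<n. \<integral>\<omega>. ((\<lambda>t\<in>{..<n}. 0 :: real) t)\<^sup>2 \<partial>sample_space n R) \<le> P i"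
      using P by simp
  qed (auto simp: space_PiM)
  interpret M: prob_space "message_space n R" by (rule prob_space_message_space)
  interpret Z: prob_space "noise_space n" by (rule prob_space_noise_space)
  interpret pair_prob_space "message_space n R" "noise_space n" ..
  show "error_prob h n R (\<lambda>i k. \<lambda>t\<in>{..<n}. 0) (\<lambda>i y. 1) \<le> 1"
    unfolding error_prob_def sample_space_def by (rule prob_le_1)
qed

text \<open>Both receivers decode all four messages.\<close>

lemma achievable_if_decodable_everywhere:
  assumes R: "\<And>i. 0 \<le> R $ i" and P: "\<And>i. 0 \<le> P i"
    and rate: "\<And>j T. T \<noteq> {} \<Longrightarrow> (\<And>i. i \<in> T \<Longrightarrow> 0 < R $ i) \<Longrightarrow>
      (\<Sum>i\<in>T. R $ i) < 1 / 2 * log 2 (1 + (\<Sum>i\<in>T. (h i j)\<^sup>2 * P i))"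
  shows "achievable P h R"
proof -
  \<comment> \<open>One \<open>\<delta>\<close> plays three roles: slack of the typicality test,
    reduction of the power to \<open>P i / (1 + \<delta>)\<close>, and tolerance for the energy of
    the codebook. Finitely many strict inequalities allow a common choice.\<close>
  define good where "good \<delta> j T \<longleftrightarrow> (\<Sum>i\<in>T. R $ i) * ln 2 < ln (1 + (\<Sum>i\<in>T. (h i j)\<^sup>2 * P i) / (1 + \<delta>)) / 2 - \<delta>"
    for \<delta> :: real and j T
  \<comment> \<open>Restricting to positive rates is essential: for a set of transmitters without
    power the strict inequality would read 0 < 0.\<close>
  let ?pos = "\<lambda>T. T \<noteq> {} \<and> (\<forall>i\<in>T. 0 < R $ i)"
  have "eventually (\<lambda>\<delta>. ?pos T \<longrightarrow> good \<delta> j T) (at_right 0)" for j T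
  proof (cases "?pos T")
    case True
    let ?S = "\<Sum>i\<in>T. (h i j)\<^sup>2 * P i"
    have S: "0 \<le> ?S" using P by (intro sum_nonneg) auto
    have "((\<lambda>\<delta>. ln (1 + ?S / (1 + \<delta>)) / 2 - \<delta>) \<longlongrightarrow> ln (1 + ?S / (1 + 0)) / 2 - 0) (at_right 0)"
      using S by (intro tendsto_intros) auto
    moreover have "(\<Sum>i\<in>T. R $ i) * ln 2 < ln (1 + ?S / (1 + 0)) / 2 - 0"
      using rate[of T j] True by (simp add: log_def field_simps)
    ultimately have "eventually (\<lambda>\<delta>. (\<Sum>i\<in>T. R $ i) * ln 2 < ln (1 + ?S / (1 + \<delta>)) / 2 - \<delta>) (at_right 0)"
      by (rule order_tendstoD(1))
    then show ?thesis by (simp add: good_def True)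
  qed (simp only: simp_thms eventually_True)
  then have "eventually (\<lambda>\<delta>. \<forall>j\<in>UNIV. \<forall>T\<in>UNIV. ?pos T \<longrightarrow> good \<delta> j T) (at_right 0)"
    by (intro eventually_ball_finite ballI) auto
  then have ev: "eventually (\<lambda>\<delta>. (\<forall>j\<in>UNIV. \<forall>T\<in>UNIV. ?pos T \<longrightarrow> good \<delta> j T) \<and> 0 < \<delta>) (at_right (0::real))"
    using eventually_at_right_less by (rule eventually_conj)
  obtain \<delta> :: real where "(\<forall>j\<in>UNIV. \<forall>T\<in>UNIV. ?pos T \<longrightarrow> good \<delta> j T) \<and> 0 < \<delta>"
    using eventually_happens'[OF trivial_limit_at_right_real ev] by (rule exE)
  then have \<delta>: "0 < \<delta>" and good: "\<And>j T. ?pos T \<Longrightarrow> good \<delta> j T" by simp_all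
  define a where "a i = sqrt (P i / (1 + \<delta>))" for i
  have a: "P i = (a i)\<^sup>2 * (1 + \<delta>)" for i
    using P[of i] \<delta> by (simp add: a_def)
  define S where "S j T = (\<Sum>i\<in>T. (h i j * a i)\<^sup>2)" for j T
  have S: "S j T = (\<Sum>i\<in>T. (h i j)\<^sup>2 * P i) / (1 + \<delta>)" for j T
    using P \<delta> by (simp add: S_def a_def power_mult_distrib sum_divide_distrib)
  define W where "W n j T = (\<Prod>i\<in>T. real (card (message_set n (R $ i))) - 1) * exp (- (n * (ln (1 + S j T) / 2 - \<delta>)))"
    for n :: nat and j T
  \<comment> \<open>The final \<open>1 / n\<close> serves to make the inequality required by
    \<open>exists_good_code\<close> strict.\<close>
  define \<epsilon> where "\<epsilon> n = (\<Sum>j\<in>UNIV. 32 / (n * \<delta>\<^sup>2) + (\<Sum>T\<in>UNIV - {{}}. W n j T)) + 8 / (n * \<delta>\<^sup>2) + 1 / n" for n :: nat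
  have W_lim: "(\<lambda>n. W n j T) \<longlonglongrightarrow> 0" if T: "T \<in> UNIV - {{}}" for j T
  proof (cases "?pos T")
    case False
    \<comment> \<open>A zero rate means exactly one message, so the number of wrong ones, a factor
      of \<open>W n j T\<close>, is zero.\<close>
    with T R obtain i where "i \<in> T" "R $ i = 0" by (metis Diff_iff insertI1 less_eq_real_def)
    then have "\<exists>i\<in>T. real (card (message_set n (R $ i))) - 1 = 0" for n
      by (intro bexI[of _ i]) (auto simp: message_set_def)
    then have "W n j T = 0" for n
      unfolding W_def by (subst prod_zero) (auto simp: finite_subset[OF subset_UNIV])
    then show ?thesis by simp
  next
    case True
    define gap where "gap = ln (1 + S j T) / 2 - \<delta> - (\<Sum>i\<in>T. R $ i) * ln 2"
    have gap: "0 < gap" using good[OF True, of j] by (simp add: gap_def good_def S)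
    have bounds: "0 \<le> W n j T" "W n j T \<le> exp (- gap) ^ n" for n
    proof -
      have nonneg: "0 \<le> real (card (message_set n (R $ i))) - 1" for i
        using message_set(2)[of n "R $ i"] by (simp add: Suc_le_eq)
      then show "0 \<le> W n j T" unfolding W_def by (intro mult_nonneg_nonneg prod_nonneg) auto
      have "W n j T \<le> (\<Prod>i\<in>T. 2 powr (n * (R $ i))) * exp (- (n * (ln (1 + S j T) / 2 - \<delta>)))"
        unfolding W_def using nonneg card_message_set_le by (intro mult_right_mono prod_mono) auto
      also have "(\<Prod>i\<in>T. 2 powr (n * (R $ i))) = exp (n * ((\<Sum>i\<in>T. R $ i) * ln 2))"
        by (simp add: powr_def exp_sum[symmetric] sum_distrib_left sum_distrib_right mult_ac finite_subset[OF subset_UNIV])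
      also have "\<dots> * exp (- (n * (ln (1 + S j T) / 2 - \<delta>))) = exp (n * (- gap))"
        by (simp add: exp_add[symmetric] gap_def algebra_simps)
      also have "\<dots> = exp (- gap) ^ n"
        by (rule exp_of_nat_mult)
      finally show "W n j T \<le> exp (- gap) ^ n" .
    qed
    have "(\<lambda>n. exp (- gap) ^ n) \<longlonglongrightarrow> 0"
      using gap by (intro LIMSEQ_power_zero) simp
    then show ?thesis
      by (rule tendsto_sandwich[OF always_eventually always_eventually tendsto_const, rotated 2]) (auto intro: bounds)
  qed
  have "\<epsilon> \<longlonglongrightarrow> (\<Sum>j\<in>(UNIV :: 2 set). 0 + (\<Sum>T\<in>(UNIV :: 4 set set) - {{}}. 0)) + 0 + 0"
  proof -
    have inv: "(\<lambda>n. c / (real n * \<delta>\<^sup>2)) \<longlonglongrightarrow> 0" for c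
      using lim_const_over_n[of "c / \<delta>\<^sup>2"] by (simp add: divide_divide_eq_left mult.commute)
    show ?thesis
      unfolding \<epsilon>_def by (intro tendsto_add tendsto_sum inv W_lim lim_const_over_n) auto
  qed
  then have \<epsilon>_lim: "\<epsilon> \<longlonglongrightarrow> 0" by simp
  have "\<exists>f g. is_code P n R f g \<and> error_prob h n R f g \<le> \<epsilon> n" if n: "1 \<le> n" for n
  proof (cases "\<epsilon> n \<le> 1")
    case True
    interpret random_codebook n R h a \<delta> using n \<delta> by unfold_locales auto
    show ?thesis
      by (rule exists_good_code[OF \<delta> a _ True]) (use n in \<open>simp add: \<epsilon>_def W_def S_def\<close>)
  next
    case False
    then show ?thesis using trivial_code[of P n R h] P by (meson dual_order.trans less_imp_le not_le)
  qed
  then obtain f g where code: "\<And>n. 1 \<le> n \<Longrightarrow> is_code P n R (f n) (g n)"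
    and err: "\<And>n. 1 \<le> n \<Longrightarrow> error_prob h n R (f n) (g n) \<le> \<epsilon> n"
    by metis
  have "(\<lambda>n. error_prob h n R (f n) (g n)) \<longlonglongrightarrow> 0"
  proof (rule tendsto_sandwich[OF _ _ tendsto_const \<epsilon>_lim])
    show "eventually (\<lambda>n. error_prob h n R (f n) (g n) \<le> \<epsilon> n) sequentially"
      using err by (auto simp: eventually_at_top_linorder)
  qed (simp add: error_prob_def)
  with code R show ?thesis unfolding achievable_def by blast
qed

section \<open>The capacity region\<close>

lemma UNIV_4_cases: "i = 1 \<or> i = 2 \<or> i = 3 \<or> i = (4 :: 4)"
  using exhaust_4 by auto

lemma distinct_4: "(1::4) \<noteq> 2" "(1::4) \<noteq> 3" "(1::4) \<noteq> 4" "(2::4) \<noteq> 3" "(2::4) \<noteq> 4" "(3::4) \<noteq> 4"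
  by simp_all

text \<open>The claimed region without the restricted functions that \<open>mac_region\<close> uses,
  so that closedness can be read off its finitely many weak inequalities.\<close>

definition rate_region :: "real \<Rightarrow> real \<Rightarrow> real \<Rightarrow> real \<Rightarrow> (real ^ 4) set" where
  "rate_region P1 P2 h1 h2 = {R. (\<forall>i. 0 \<le> R $ i) \<and>
     (\<forall>T\<subseteq>{1, 2, 3}. (\<Sum>i\<in>T. R $ i) \<le> 1/2 * log 2 (1 + (\<Sum>i\<in>T. (imac_gain h1 h2 i 1)\<^sup>2 * imac_power P1 P2 i))) \<and>
     (\<forall>T\<subseteq>{1, 3, 4}. (\<Sum>i\<in>T. R $ i) \<le> 1/2 * log 2 (1 + (\<Sum>i\<in>T. (imac_gain h1 h2 i 2)\<^sup>2 * imac_power P1 P2 i)))}"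

lemma rate_region_eq:
  "{R. (\<forall>i. 0 \<le> R $ i) \<and>
        (\<lambda>i\<in>{1, 2, 3}. R $ i) \<in> imac_mac_region P1 P2 h1 h2 {1, 2, 3} 1 \<and>
        (\<lambda>i\<in>{1, 3, 4}. R $ i) \<in> imac_mac_region P1 P2 h1 h2 {1, 3, 4} 2} = rate_region P1 P2 h1 h2"
proof -
  have "(\<lambda>i\<in>S. R $ i) \<in> imac_mac_region P1 P2 h1 h2 S j \<longleftrightarrow>
      (\<forall>T\<subseteq>S. (\<Sum>i\<in>T. R $ i) \<le> 1/2 * log 2 (1 + (\<Sum>i\<in>T. (imac_gain h1 h2 i j)\<^sup>2 * imac_power P1 P2 i)))"
    if "\<forall>i. 0 \<le> R $ i" for R :: "real ^ 4" and S j
  proof -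
    have "(\<Sum>i\<in>T. (\<lambda>i\<in>S. R $ i) i) = (\<Sum>i\<in>T. R $ i)" if "T \<subseteq> S" for T
      using that by (intro sum.cong) auto
    then show ?thesis
      using that by (auto simp: imac_mac_region_def mac_region_def)
  qed
  then show ?thesis unfolding rate_region_def by blast
qed

lemma imac_power_nonneg: "0 \<le> P1 \<Longrightarrow> 0 \<le> P2 \<Longrightarrow> 0 \<le> imac_power P1 P2 i"
  by (simp add: imac_power_def)

lemma closed_rate_region: "closed (rate_region P1 P2 h1 h2)"
  unfolding rate_region_def
  by (intro closed_Collect_conj closed_Collect_all closed_Collect_imp open_Collect_const closed_Collect_le continuous_intros)

text \<open>Receiver 1 is given message 4 and imitates receiver 2 for message 3; receiver 2 is given
  message 2 and imitates receiver 1 for message 1. In both cases \<open>1 \<le> h1\<^sup>2\<close>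
  is the required comparison of gains.\<close>

lemma achievable_subset_rate_region:
  assumes P: "0 \<le> P1" "0 \<le> P2" and h1: "1 \<le> h1\<^sup>2"
    and ach: "achievable (imac_power P1 P2) (imac_gain h1 h2) R"
  shows "R \<in> rate_region P1 P2 h1 h2"
proof -
  have h1': "h1 \<noteq> 0" using h1 by auto
  have "(\<Sum>i\<in>T. R $ i) \<le> 1/2 * log 2 (1 + (\<Sum>i\<in>T. (imac_gain h1 h2 i 1)\<^sup>2 * imac_power P1 P2 i))"
    if T: "T \<subseteq> {1, 2, 3}" for T
  proof (rule achievable_sum_rate_le[OF ach imac_power_nonneg[OF P], where c=3 and d=4 and j=1 and j'=2])
    fix i :: 4 assume "i \<noteq> 3" "i \<noteq> 4"
    then show "intended_receiver i = 1"
      using UNIV_4_cases[of i] by (auto simp: intended_receiver_def)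
  next
    show "(4::4) \<notin> T" using T distinct_4 by auto
  qed (use h1 h1' in \<open>auto simp: imac_gain_def intended_receiver_def\<close>)
  moreover have "(\<Sum>i\<in>T. R $ i) \<le> 1/2 * log 2 (1 + (\<Sum>i\<in>T. (imac_gain h1 h2 i 2)\<^sup>2 * imac_power P1 P2 i))"
    if T: "T \<subseteq> {1, 3, 4}" for T
  proof (rule achievable_sum_rate_le[OF ach imac_power_nonneg[OF P], where c=1 and d=2 and j=2 and j'=1])
    fix i :: 4 assume "i \<noteq> 1" "i \<noteq> 2"
    then show "intended_receiver i = 2"
      by (auto simp: intended_receiver_def)
  next
    show "(2::4) \<notin> T" using T distinct_4 by auto
  qed (use h1 h1' in \<open>auto simp: imac_gain_def intended_receiver_def\<close>)
  moreover have "\<forall>i. 0 \<le> R $ i" using ach by (simp add: achievable_def)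
  ultimately show ?thesis by (simp add: rate_region_def)
qed

text \<open>
  The very strong interferer \<open>d\<close> is decodable while everything else is treated as noise, so its rate
  constraint at its own receiver \<open>j'\<close> implies all constraints involving it at receiver \<open>j\<close>.
\<close>

lemma sum_rate_very_strong_interferer:
  fixes T :: "4 set" and r P :: "4 \<Rightarrow> real"
  assumes P: "\<And>i. 0 \<le> P i"
    and T: "(\<Sum>i\<in>T - {d}. r i) \<le> 1/2 * log 2 (1 + (\<Sum>i\<in>T - {d}. (h i j)\<^sup>2 * P i))"
    and d: "r d \<le> 1/2 * log 2 (1 + P d)" "d \<in> T"
    and strong: "1 + (\<Sum>i\<in>T - {d}. (h i j)\<^sup>2 * P i) \<le> (h d j)\<^sup>2"
  shows "(\<Sum>i\<in>T. r i) \<le> 1/2 * log 2 (1 + (\<Sum>i\<in>T. (h i j)\<^sup>2 * P i))"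
proof -
  let ?S = "\<Sum>i\<in>T - {d}. (h i j)\<^sup>2 * P i"
  have fin: "finite T" by (rule finite_subset[OF subset_UNIV]) simp
  have S: "0 \<le> ?S" using P by (intro sum_nonneg) auto
  have "(\<Sum>i\<in>T. r i) \<le> 1/2 * log 2 (1 + P d) + 1/2 * log 2 (1 + ?S)"
    using T d fin by (simp add: sum.remove[of T d])
  also have "\<dots> = 1/2 * log 2 ((1 + P d) * (1 + ?S))"
    using S P[of d] by (subst log_mult) (auto simp: add_pos_nonneg)
  also have "\<dots> \<le> 1/2 * log 2 (1 + (\<Sum>i\<in>T. (h i j)\<^sup>2 * P i))"
  proof -
    have "P d * (1 + ?S) \<le> P d * (h d j)\<^sup>2" using strong P by (intro mult_left_mono) auto
    then have le: "(1 + P d) * (1 + ?S) \<le> 1 + (\<Sum>i\<in>T. (h i j)\<^sup>2 * P i)"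
      using d fin by (simp add: sum.remove[of T d] algebra_simps)
    have pos: "0 < (1 + P d) * (1 + ?S)"
      using S P[of d] by (intro mult_pos_pos) auto
    show ?thesis
      using le pos less_le_trans[OF pos le] by simp
  qed
  finally show ?thesis .
qed

text \<open>The region constrains only sets without the strong interferer of each receiver. These
  bounds extend to all sets of transmitters, and scaling makes them strict wherever the rates are
  positive.\<close>

lemma rate_region_scaled_achievable:
  assumes P: "0 \<le> P1" "0 \<le> P2" and strong: "1 + P1 + P2 + h1\<^sup>2 * P1 \<le> h2\<^sup>2"
    and R: "R \<in> rate_region P1 P2 h1 h2" and l: "0 \<le> l" "l < 1"
  shows "achievable (imac_power P1 P2) (imac_gain h1 h2) (l *\<^sub>R R)"
proof (rule achievable_if_decodable_everywhere)
  let ?P = "imac_power P1 P2" and ?h = "imac_gain h1 h2"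
  have R0: "0 \<le> R $ i" for i using R by (simp add: rate_region_def)
  show "0 \<le> (l *\<^sub>R R) $ i" for i using R0 l by simp
  show "0 \<le> ?P i" for i by (rule imac_power_nonneg[OF P])
  have region1: "(\<Sum>i\<in>T. R $ i) \<le> 1/2 * log 2 (1 + (\<Sum>i\<in>T. (?h i 1)\<^sup>2 * ?P i))" if "T \<subseteq> {1, 2, 3}" for T
    using R that by (simp add: rate_region_def)
  have region2: "(\<Sum>i\<in>T. R $ i) \<le> 1/2 * log 2 (1 + (\<Sum>i\<in>T. (?h i 2)\<^sup>2 * ?P i))" if "T \<subseteq> {1, 3, 4}" for T
    using R that by (simp add: rate_region_def)
  have bound: "(\<Sum>i\<in>T. R $ i) \<le> 1/2 * log 2 (1 + (\<Sum>i\<in>T. (?h i j)\<^sup>2 * ?P i))" for T j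
  proof (cases "j = 1")
    case True
    have sub: "T - {4} \<subseteq> {1, 2, 3}" using UNIV_4_cases by auto
    show ?thesis
    proof (cases "4 \<in> T")
      case T4: True
      have "(\<Sum>i\<in>T - {4}. (?h i 1)\<^sup>2 * ?P i) \<le> (\<Sum>i\<in>{1, 2, 3}. (?h i 1)\<^sup>2 * ?P i)"
        using sub imac_power_nonneg[OF P] by (intro sum_mono2) auto
      \<comment> \<open>Together with the unit noise this is exactly the threshold for
        \<open>h2\<^sup>2\<close>. By the symmetry of the channel the same total arises at receiver
        2.\<close>
      also have "\<dots> = P1 + P2 + h1\<^sup>2 * P1"
        by (simp add: imac_gain_def imac_power_def)
      finally have "1 + (\<Sum>i\<in>T - {4}. (?h i 1)\<^sup>2 * ?P i) \<le> (?h 4 1)\<^sup>2"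
        using strong by (simp add: imac_gain_def)
      \<comment> \<open>The rate of the strong interferer is limited at its own receiver, where its
        gain is one.\<close>
      moreover have "R $ 4 \<le> 1/2 * log 2 (1 + ?P 4)"
        using region2[of "{4}"] by (simp add: imac_gain_def)
      ultimately show ?thesis
        unfolding True using sum_rate_very_strong_interferer[where h="?h" and j=1 and d=4 and r="($) R", OF imac_power_nonneg[OF P] region1[OF sub] _ T4]
        by simp
    next
      case False
      then show ?thesis using sub region1[of T] True by simp
    qed
  next
    case False
    then have j: "j = 2" using exhaust_2 by blast
    have sub: "T - {2} \<subseteq> {1, 3, 4}" using UNIV_4_cases by auto
    show ?thesis
    proof (cases "2 \<in> T")
      case T2: True
      have "(\<Sum>i\<in>T - {2}. (?h i 2)\<^sup>2 * ?P i) \<le> (\<Sum>i\<in>{1, 3, 4}. (?h i 2)\<^sup>2 * ?P i)"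
        using sub imac_power_nonneg[OF P] by (intro sum_mono2) auto
      also have "\<dots> = P1 + P2 + h1\<^sup>2 * P1"
        by (simp add: imac_gain_def imac_power_def)
      finally have "1 + (\<Sum>i\<in>T - {2}. (?h i 2)\<^sup>2 * ?P i) \<le> (?h 2 2)\<^sup>2"
        using strong by (simp add: imac_gain_def)
      moreover have "R $ 2 \<le> 1/2 * log 2 (1 + ?P 2)"
        using region1[of "{2}"] by (simp add: imac_gain_def)
      ultimately show ?thesis
        unfolding j using sum_rate_very_strong_interferer[where h="?h" and j=2 and d=2 and r="($) R", OF imac_power_nonneg[OF P] region2[OF sub] _ T2]
        by simp
    next
      case False
      then show ?thesis using sub region2[of T] j by simp
    qed
  qed
  fix j :: 2 and T :: "4 set"
  assume T: "T \<noteq> {}" and pos: "\<And>i. i \<in> T \<Longrightarrow> 0 < (l *\<^sub>R R) $ i"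
  have "0 < R $ i" if "i \<in> T" for i
    using pos[OF that] R0[of i] by (cases "R $ i = 0") (auto simp: less_le)
  then have "0 < (\<Sum>i\<in>T. R $ i)"
    using T by (intro sum_pos) (auto simp: finite_subset[OF subset_UNIV])
  \<comment> \<open>Strictness rests on the sum being positive, which is why only sets of positive
    rates are considered.\<close>
  then have "(\<Sum>i\<in>T. (l *\<^sub>R R) $ i) < (\<Sum>i\<in>T. R $ i)"
    using l by (simp add: sum_distrib_left[symmetric])
  with bound[of T j] show "(\<Sum>i\<in>T. (l *\<^sub>R R) $ i) < 1/2 * log 2 (1 + (\<Sum>i\<in>T. (?h i j)\<^sup>2 * ?P i))"
    by linarith
qed

theorem theorem1:
  fixes P1 P2 h1 h2 :: real
  assumes "P1 \<ge> 0" and "P2 \<ge> 0"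
    and "mses_1_2 P1 P2 h1 h2"
  shows "imac_capacity_region P1 P2 h1 h2 =
    {R. (\<forall>i. 0 \<le> R $ i) \<and>
        (\<lambda>i\<in>{1, 2, 3}. R $ i) \<in> imac_mac_region P1 P2 h1 h2 {1, 2, 3} 1 \<and>
        (\<lambda>i\<in>{1, 3, 4}. R $ i) \<in> imac_mac_region P1 P2 h1 h2 {1, 3, 4} 2}"
proof -
  have h: "1 + P1 + P2 + h1\<^sup>2 * P1 \<le> h2\<^sup>2" "1 \<le> h1\<^sup>2"
    using assms(3) by (auto simp: mses_1_2_def)
  let ?ach = "{R. achievable (imac_power P1 P2) (imac_gain h1 h2) R}"
  have "closure ?ach = rate_region P1 P2 h1 h2"
  proof
    show "closure ?ach \<subseteq> rate_region P1 P2 h1 h2"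
      using achievable_subset_rate_region[OF assms(1,2) h(2)]
      by (intro closure_minimal closed_rate_region) auto
    show "rate_region P1 P2 h1 h2 \<subseteq> closure ?ach"
    proof
      fix R assume R: "R \<in> rate_region P1 P2 h1 h2"
      have "((\<lambda>l. l *\<^sub>R R) \<longlongrightarrow> 1 *\<^sub>R R) (at_left 1)"
        by (intro tendsto_intros)
      moreover have "eventually (\<lambda>l. l *\<^sub>R R \<in> ?ach) (at_left 1)"
        using eventually_at_left_real[OF zero_less_one]
      proof eventually_elim
        case (elim l)
        then show ?case using rate_region_scaled_achievable[OF assms(1,2) h(1) R] by simp
      qed
      then have "eventually (\<lambda>l. l *\<^sub>R R \<in> closure ?ach) (at_left 1)"
        by (rule eventually_mono) (rule subsetD[OF closure_subset])
      ultimately show "R \<in> closure ?ach"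
        using Lim_in_closed_set[OF closed_closure _ trivial_limit_at_left_real] by fastforce
    qed
  qed
  then show ?thesis
    by (simp add: imac_capacity_region_def capacity_region_def rate_region_eq)
qed

end
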